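(* For any integer $b\ge 2$, we have for any integer $\lambda\ge 1$, $$\bigl|\{\,p\text{ prime}: b^{\lambda-1}\le p<b^\lambda,\ R_\lambda(p)\text{ is prime}\,\}\bigr|\ll\frac{b^\lambda}{\lambda^2},$$ where the implicit constant depends at most on $b$.
   Context: For integers $b\ge2$ and $n\ge 0$ write $n=\sum_{j\ge 0}\varepsilon_j(n)b^j$ with $\varepsilon_j(n)\in\{0,\dots,b-1\}$ (base-$b$ digits), and for $\lambda\ge 0$ set $R_\lambda(n)=\sum_{j=0}^{\lambda-1}\varepsilon_j(n)\,b^{\lambda-1-j}$ (with $R_0(n)=0$). *)

theory Defs
  imports Complex_Main "HOL-Computational_Algebra.Primes"
begin

definition digit :: "nat \<Rightarrow> nat \<Rightarrow> nat \<Rightarrow> nat" where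
  "digit b n j = (n div b ^ j) mod b"

text \<open>
  The two lemmas below confirm that these are the base-b digits of n. The infinite sum of the
  digit expansion is cut off at any k with n < b ^ k, beyond which all digits vanish.
\<close>

lemma digit_less: "b \<ge> 2 \<Longrightarrow> digit b n j < b"
  by (simp add: digit_def)

lemma digit_expansion:
  assumes "n < b ^ k"
  shows "n = (\<Sum>j<k. digit b n j * b ^ j)"
proof -
  have "n mod b ^ k = (\<Sum>j<k. digit b n j * b ^ j)" for k
  proof (induction k)
    case (Suc k)
    have "n mod b ^ Suc k = b ^ k * (n div b ^ k mod b) + n mod b ^ k"
      by (metis mod_mult2_eq power_Suc2)
    then show ?case using Suc by (simp add: digit_def algebra_simps)
  qed simp
  then show ?thesis using assms by (metis mod_less)
qed

text \<open>The argument l is the number of digits that are reversed.\<close>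

definition digit_reverse :: "nat \<Rightarrow> nat \<Rightarrow> nat \<Rightarrow> nat" where
  "digit_reverse b l n = (\<Sum>j<l. digit b n j * b ^ (l - 1 - j))"

end

theory Submission
  imports Defs "HOL-Analysis.Harmonic_Numbers" "HOL-Number_Theory.Cong"
    "HOL-Computational_Algebra.Squarefree"
begin

text \<open>
Write \<open>e(t) = exp (2 \<pi> i t)\<close>, \<open>N = b ^ l\<close>, and \<open>R(n)\<close> for the reversal of \<open>n < N\<close>. The primes in
question survive a sieve in two variables: apart from few exceptions, neither \<open>n\<close> nor \<open>R(n)\<close> has a
prime factor up to \<open>Q\<close>, where \<open>Q\<close> is a small fixed power of \<open>N\<close>. If the events \<open>r dvd n\<close> and
\<open>s dvd R(n)\<close> behave on average like independent events of probabilities \<open>1 / r\<close> and \<open>1 / s\<close>, then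
Selberg's sieve applied to both coordinates keeps at most a proportion of order \<open>1 / (ln Q)^2\<close> of the
integers below \<open>N\<close>, which is the claim.

Independence comes from exponential sums. By orthogonality the number of \<open>n < N\<close> with
\<open>r dvd n\<close> and \<open>s dvd R(n)\<close> is \<open>1 / (r s)\<close> times the sum over \<open>h < r\<close>, \<open>k < s\<close> of
\<open>F(h / r, k / s)\<close>, where \<open>F(x, y)\<close> is the sum of \<open>e(x n + y R(n))\<close> over \<open>n < N\<close>. The digits of \<open>n\<close>
are free, so \<open>F\<close> is a product over the digit positions \<open>j\<close> of the sums of \<open>e(d t_j)\<close> over the digits \<open>d\<close>,
with \<open>t_j = x b^j + y b^(l-1-j)\<close>. The combination
\<open>t_(j+1) - b t_j\<close> contains only \<open>y\<close>, and \<open>t_j - b t_(j+1)\<close> contains only \<open>x\<close>; both carry the factor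
\<open>b^2 - 1\<close>. If such a combination is not close to an integer, one of the two factors is smaller than
\<open>b\<close> by a constant ratio. Spending the lower half of the positions on \<open>y\<close> and the upper half on \<open>x\<close>
gives a bound for \<open>F(x, y)\<close> that is a product of a function of \<open>x\<close> and a function of \<open>y\<close>
(\<open>phase_sum_bound\<close>): each is a power of some \<open>c < 1\<close> whose exponent counts the multiples \<open>B^i x\<close>,
\<open>B = b ^ 10\<close>, that are far from the integers. Primes dividing \<open>b (b^2 - 1)\<close> are left out of the
sieve, so multiplication by powers of \<open>b\<close> and by \<open>b^2 - 1\<close> permutes the fractions that occur.

It remains to sum these powers over reduced fractions \<open>h / d\<close>, with weight about \<open>1 / sqrt d\<close>. Take all
denominators in \<open>[B^(k-1), B^k)\<close>. In every block of \<open>2 k\<close> consecutive exponents \<open>i\<close> at least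
one \<open>B^i h / d\<close> is far from the integers, because otherwise \<open>h / d\<close> would itself be an integer. On
the other hand the fractions are separated by more than \<open>B^(-2k)\<close>, so the first \<open>2 k\<close> base-\<open>B\<close> digits
tell them apart, and \<open>B^i h / d\<close> can only be near an integer when the corresponding digit is \<open>0\<close> or
\<open>B - 1\<close>. Using a large constant number of blocks, a digit different from these two brings in
at most a factor \<open>1 / B\<close>, and the sum over all digit strings is at most \<open>3 ^ (2 k) = 9 ^ k\<close>, far below the
weight \<open>b ^ (5 k) \<ge> 32 ^ k\<close>. The remaining blocks give the factor \<open>sqrt c ^ (m div (2 k))\<close>, \<open>m\<close> being
proportional to \<open>l\<close>. Summation over \<open>k\<close> beats every
fixed power of \<open>l\<close> (\<open>far_sum_reduced_total\<close>), which absorbs the logarithmic losses of the sieve.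

The sieve is indexed by finite sets of primes instead of squarefree integers, so that least common
multiples are unions, greatest common divisors are intersections, and Moebius inversion is the
binomial theorem (\<open>selberg_diagonal\<close>, \<open>joint_sieve\<close>).
\<close>

section \<open>Exponential sums over digits\<close>

text \<open>
The digits of the integers below \<open>b ^ k\<close> run independently through all \<open>k\<close>-tuples.
\<close>
lemma sum_prod_digits:
  fixes f :: "nat \<Rightarrow> nat \<Rightarrow> 'a::comm_semiring_1"
  assumes "b > 0"
  shows "(\<Sum>n<b ^ k. \<Prod>j<k. f j (digit b n j)) = (\<Prod>j<k. \<Sum>e<b. f j e)"
proof (induction k)
  case (Suc k)
  have "(\<Sum>n<b ^ Suc k. \<Prod>j<Suc k. f j (digit b n j))
      = (\<Sum>e<b. \<Sum>n = e * b ^ k..<e * b ^ k + b ^ k. \<Prod>j<Suc k. f j (digit b n j))"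
    by (simp only: power_Suc sum.nat_group[symmetric])
  also have "\<dots> = (\<Sum>e<b. \<Sum>n<b ^ k. \<Prod>j<Suc k. f j (digit b (n + e * b ^ k) j))"
  proof (rule sum.cong[OF refl])
    fix e
    show "(\<Sum>n = e * b ^ k..<e * b ^ k + b ^ k. \<Prod>j<Suc k. f j (digit b n j))
        = (\<Sum>n<b ^ k. \<Prod>j<Suc k. f j (digit b (n + e * b ^ k) j))"
      by (rule sum.reindex_bij_witness[where
          i = "\<lambda>n. n + e * b ^ k" and j = "\<lambda>n. n - e * b ^ k"]) auto
  qed
  also have "\<dots> = (\<Sum>e<b. \<Sum>n<b ^ k. (\<Prod>j<k. f j (digit b n j)) * f k e)"
  proof (intro sum.cong refl)
    fix e n assume e: "e \<in> {..<b}" and n: "n \<in> {..<b ^ k}"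
    have "digit b (n + e * b ^ k) j = digit b n j" if "j < k" for j
    proof -
      have "b ^ k = b ^ j * (b * b ^ (k - Suc j))"
        using that by (metis Suc_leI add_Suc_right le_add_diff_inverse2 power_Suc power_add add.commute)
      then have "(n + e * b ^ k) div b ^ j = n div b ^ j + b * (e * b ^ (k - Suc j))"
        using assms by (simp add: mult.left_commute[of e] mult.assoc)
      then show ?thesis unfolding digit_def by simp
    qed
    moreover have "digit b (n + e * b ^ k) k = e"
      using e n assms by (simp add: digit_def)
    ultimately show "(\<Prod>j<Suc k. f j (digit b (n + e * b ^ k) j)) = (\<Prod>j<k. f j (digit b n j)) * f k e"
      by simp
  qed
  also have "\<dots> = (\<Prod>j<k. \<Sum>e<b. f j e) * (\<Sum>e<b. f k e)"
    unfolding Suc.IH[symmetric] sum_product by (rule sum.swap)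
  finally show ?case by simp
qed simp

lemma cis_sum: "finite A \<Longrightarrow> cis (\<Sum>x\<in>A. f x) = (\<Prod>x\<in>A. cis (f x))"
  by (induction rule: finite_induct) (simp_all flip: cis_mult)

definition digit_phase_sum :: "nat \<Rightarrow> real \<Rightarrow> complex" where
  "digit_phase_sum b t = (\<Sum>e<b. cis (2 * pi * (real e * t)))"

lemma phase_sum_factorises:
  assumes "b \<ge> 2"
  shows "(\<Sum>n<b ^ l. cis (2 * pi * (s * real n + t * real (digit_reverse b l n))))
    = (\<Prod>j<l. digit_phase_sum b (s * real b ^ j + t * real b ^ (l - 1 - j)))"
proof -
  have "cis (2 * pi * (s * real n + t * real (digit_reverse b l n)))
     = (\<Prod>j<l. cis (2 * pi * (real (digit b n j) * (s * real b ^ j + t * real b ^ (l - 1 - j)))))"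
    if "n < b ^ l" for n
  proof -
    have "real n = (\<Sum>j<l. real (digit b n j) * real b ^ j)"
      by (subst digit_expansion[OF that]) simp
    moreover have "real (digit_reverse b l n) = (\<Sum>j<l. real (digit b n j) * real b ^ (l - 1 - j))"
      by (simp add: digit_reverse_def)
    ultimately have "2 * pi * (s * real n + t * real (digit_reverse b l n))
       = (\<Sum>j<l. 2 * pi * (real (digit b n j) * (s * real b ^ j + t * real b ^ (l - 1 - j))))"
      by (simp add: sum_distrib_left sum.distrib[symmetric] algebra_simps)
    then show ?thesis by (simp add: cis_sum)
  qed
  then show ?thesis
    unfolding digit_phase_sum_def
    using assms by (subst sum_prod_digits[symmetric]) auto
qed

text \<open>
Distance to the nearest integer below \<open>d\<close>; the form with a witness avoids rounding.
\<close>
definition near_int :: "real \<Rightarrow> real \<Rightarrow> bool" where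
  "near_int d t \<longleftrightarrow> (\<exists>z::int. \<bar>t - of_int z\<bar> < d)"

lemma near_int_minus [simp]: "near_int d (- t) \<longleftrightarrow> near_int d t"
proof -
  have "near_int d (- t)" if "near_int d t" for t
  proof -
    from that obtain z :: int where "\<bar>t - of_int z\<bar> < d" by (auto simp: near_int_def)
    then show ?thesis unfolding near_int_def by (intro exI[of _ "- z"]) auto
  qed
  from this[of t] this[of "- t"] show ?thesis by auto
qed

lemma near_int_add_int [simp]: "near_int d (t + of_int k) \<longleftrightarrow> near_int d t"
proof -
  have "near_int d (t + of_int k)" if "near_int d t" for t k
  proof -
    from that obtain z :: int where "\<bar>t - of_int z\<bar> < d" by (auto simp: near_int_def)
    then show ?thesis unfolding near_int_def by (intro exI[of _ "z + k"]) auto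
  qed
  from this[of t k] this[of "t + of_int k" "- k"] show ?thesis by auto
qed

lemma norm_digit_phase_sum_le: "norm (digit_phase_sum b t) \<le> real b"
proof -
  have "norm (digit_phase_sum b t) \<le> (\<Sum>e<b. norm (cis (2 * pi * (real e * t))))"
    unfolding digit_phase_sum_def by (rule norm_sum)
  then show ?thesis by simp
qed

text \<open>
The terms of the digits 0 and 1 already fail to point in the same direction, and the other \<open>b - 2\<close>
terms are bounded trivially.
\<close>
lemma digit_phase_sum_saving:
  assumes b: "b \<ge> 2" and d: "0 < d" "d < 1 / 2"
  obtains c where "0 < c" "c < 1" "\<And>t. \<not> near_int d t \<Longrightarrow> norm (digit_phase_sum b t) \<le> c * real b"
proof -
  define r where "r = sqrt (2 + 2 * cos (2 * pi * d))"
  have "2 * pi * d < pi" using d by simp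
  then have "cos (2 * pi * d) < 1" using d cos_monotone_0_pi[of 0 "2 * pi * d"] by simp
  then have r2: "r < 2" unfolding r_def by (intro real_less_lsqrt) auto
  have "cos pi < cos (2 * pi * d)" using d cos_monotone_0_pi[of "2 * pi * d" pi] by simp
  then have r0: "r > 0" unfolding r_def by simp
  have bound: "norm (digit_phase_sum b t) \<le> real b - 2 + r" if "\<not> near_int d t" for t
  proof -
    define u where "u = t - of_int (round t)"
    have u: "d \<le> \<bar>u\<bar>" "\<bar>u\<bar> \<le> 1 / 2"
      using that of_int_round_abs_le[of t] by (auto simp: near_int_def u_def not_less abs_minus_commute)
    have "cos (2 * pi * t) = cos (2 * pi * u + 2 * pi * of_int (round t))"
      by (simp add: u_def algebra_simps)
    also have "\<dots> = cos (2 * pi * u)"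
      using cos_int_2pin sin_int_2pin by (simp add: cos_add)
    also have "\<dots> = cos (2 * pi * \<bar>u\<bar>)" by (cases "u \<ge> 0") (auto simp: abs_if)
    also have "\<dots> \<le> cos (2 * pi * d)" using u d by (intro cos_monotone_0_pi_le) auto
    finally have c: "cos (2 * pi * t) \<le> cos (2 * pi * d)" .
    have "norm (1 + cis (2 * pi * t)) = sqrt ((1 + cos (2 * pi * t))\<^sup>2 + (sin (2 * pi * t))\<^sup>2)"
      by (simp add: cmod_def)
    also have "(1 + cos (2 * pi * t))\<^sup>2 + (sin (2 * pi * t))\<^sup>2 = 2 + 2 * cos (2 * pi * t)"
      using sin_cos_squared_add2[of "2 * pi * t"] by (simp add: power2_eq_square algebra_simps)
    also have "sqrt \<dots> \<le> r" using c by (simp add: r_def)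
    finally have two: "norm (1 + cis (2 * pi * t)) \<le> r" .
    obtain k where k: "b = Suc (Suc k)" using le_Suc_ex[OF b] by auto
    have "digit_phase_sum b t = (1 + cis (2 * pi * t)) + (\<Sum>e<k. cis (2 * pi * (real (Suc (Suc e)) * t)))"
      unfolding digit_phase_sum_def k by (simp only: sum.lessThan_Suc_shift) simp
    also have "norm \<dots> \<le> r + (\<Sum>e<k. norm (cis (2 * pi * (real (Suc (Suc e)) * t))))"
      by (intro norm_triangle_mono two norm_sum)
    finally show ?thesis by (simp add: k)
  qed
  show ?thesis
  proof (rule that[of "(real b - 2 + r) / real b"])
    show "0 < (real b - 2 + r) / real b" "(real b - 2 + r) / real b < 1" using b r0 r2 by (auto simp: field_simps)
  qed (use bound b in auto)
qed

text \<open>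
If both \<open>s\<close> and \<open>t\<close> were within \<open>d / (b + 1)\<close> of integers, \<open>t - b s\<close> would be within \<open>d\<close> of one.
\<close>
lemma digit_phase_sum_pair_saving:
  assumes b: "b \<ge> 2" and d: "0 < d" "d < 1 / 2"
  obtains c where "0 < c" "c < 1"
    "\<And>s t. \<not> near_int d (t - real b * s) \<Longrightarrow>
       norm (digit_phase_sum b s) * norm (digit_phase_sum b t) \<le> c * real b ^ 2"
proof -
  define e where "e = d / (real b + 1)"
  have e: "0 < e" "e < 1 / 2" using d b by (auto simp: e_def field_simps)
  obtain c where c: "0 < c" "c < 1" "\<And>t. \<not> near_int e t \<Longrightarrow> norm (digit_phase_sum b t) \<le> c * real b"
    using digit_phase_sum_saving[OF b e] by blast
  show ?thesis
  proof (rule that[OF c(1,2)])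
    fix s t assume far: "\<not> near_int d (t - real b * s)"
    have "\<not> near_int e s \<or> \<not> near_int e t"
    proof (rule ccontr)
      assume "\<not> ?thesis"
      then obtain y z :: int where yz: "\<bar>s - of_int y\<bar> < e" "\<bar>t - of_int z\<bar> < e"
        by (auto simp: near_int_def)
      have "\<bar>(t - real b * s) - of_int (z - int b * y)\<bar> = \<bar>(t - of_int z) - real b * (s - of_int y)\<bar>"
        by (simp add: algebra_simps)
      also have "\<dots> \<le> \<bar>t - of_int z\<bar> + real b * \<bar>s - of_int y\<bar>"
        by (metis abs_mult abs_of_nat abs_triangle_ineq4)
      also have "\<dots> < e + real b * e" using yz b by (intro add_strict_mono) auto
      also have "\<dots> = (real b + 1) * e" by (simp add: algebra_simps)
      also have "\<dots> = d" by (simp add: e_def)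
      finally show False using far unfolding near_int_def by blast
    qed
    then show "norm (digit_phase_sum b s) * norm (digit_phase_sum b t) \<le> c * real b ^ 2"
    proof
      assume "\<not> near_int e s"
      then have "norm (digit_phase_sum b s) * norm (digit_phase_sum b t) \<le> (c * real b) * real b"
        using c norm_digit_phase_sum_le[of b t] by (intro mult_mono) auto
      then show ?thesis by (simp add: power2_eq_square)
    next
      assume "\<not> near_int e t"
      then have "norm (digit_phase_sum b s) * norm (digit_phase_sum b t) \<le> real b * (c * real b)"
        using c norm_digit_phase_sum_le[of b s] by (intro mult_mono) auto
      then show ?thesis by (simp add: power2_eq_square mult.left_commute)
    qed
  qed
qed

text \<open>
The exponent of the saving. Only every tenth power of \<open>b\<close> is tested: each test consumes two adjacent
digit positions, and the larger base \<open>B = b ^ 10\<close> makes the counting of digit strings below efficient. The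
threshold \<open>1 / (2 B)\<close> is what makes nearness visible in a single base-\<open>B\<close> digit.
\<close>
definition far_count :: "nat \<Rightarrow> nat \<Rightarrow> real \<Rightarrow> nat" where
  "far_count b m t = card {i. i < m \<and> \<not> near_int (1 / (2 * real b ^ 10)) (real b ^ (10 * i) * t)}"

lemma far_count_sum:
  "far_count b m t = (\<Sum>i<m. of_bool (\<not> near_int (1 / (2 * real b ^ 10)) (real b ^ (10 * i) * t)))"
proof -
  have "{..<m} \<inter> {i. \<not> near_int (1 / (2 * real b ^ 10)) (real b ^ (10 * i) * t)}
     = {i. i < m \<and> \<not> near_int (1 / (2 * real b ^ 10)) (real b ^ (10 * i) * t)}" by auto
  then show ?thesis by (simp add: far_count_def sum_of_bool_eq)
qed

lemma sum_lessThan_add: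
  fixes f :: "nat \<Rightarrow> 'a::comm_monoid_add"
  shows "(\<Sum>i<m + n. f i) = (\<Sum>i<m. f i) + (\<Sum>i<n. f (m + i))"
  by (induction n) (simp_all add: add.assoc)

text \<open>
Of each ten consecutive factors the first two bring the saving, and the other eight are bounded by \<open>B\<close>.
\<close>
lemma prod_blocks_le:
  fixes a :: "nat \<Rightarrow> real" and c :: real
  assumes a: "\<And>j. 0 \<le> a j" "\<And>j. a j \<le> B"
    and pair: "\<And>i. i < k \<Longrightarrow> a (10 * i) * a (10 * i + 1) \<le> c ^ x i * B ^ 2"
    and c: "0 \<le> c"
  shows "(\<Prod>j<10 * k. a j) \<le> B ^ (10 * k) * c ^ (\<Sum>i<k. x i)"
  using pair
proof (induction k)
  case (Suc k)
  have B: "0 \<le> B" using a[of 0] by linarith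
  have "(\<Prod>j<10 * Suc k. a j) = (\<Prod>j<10 * k. a j) * ((a (10 * k) * a (10 * k + 1)) * (\<Prod>j<8. a (10 * k + 2 + j)))"
    by (simp add: eval_nat_numeral mult.assoc)
  also have "\<dots> \<le> (B ^ (10 * k) * c ^ (\<Sum>i<k. x i)) * ((c ^ x k * B ^ 2) * (\<Prod>j<(8::nat). B))"
  proof (intro mult_mono[OF Suc.IH mult_mono])
    show "(\<Prod>j<8. a (10 * k + 2 + j)) \<le> (\<Prod>j<(8::nat). B)" using a by (intro prod_mono) auto
  qed (use Suc.prems a B c in \<open>auto intro!: mult_nonneg_nonneg prod_nonneg\<close>)
  also have "\<dots> = B ^ (10 * Suc k) * c ^ (\<Sum>i<Suc k. x i)"
    by (simp add: power_add algebra_simps eval_nat_numeral)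
  finally show ?case .
qed simp

text \<open>
The positions \<open>10 i\<close> with \<open>i < m\<close> are used to eliminate \<open>s\<close>, those with \<open>m \<le> i < 2 m\<close> to eliminate
\<open>t\<close>. The exponents \<open>u\<close> and \<open>v\<close> are uniform in \<open>s\<close> and \<open>t\<close>, so that the dilations can later be undone
by permuting fractions with denominators coprime to \<open>b * (b ^ 2 - 1)\<close>.
\<close>
proposition phase_sum_bound:
  assumes b: "b \<ge> 2"
  obtains c where "0 < c" "c < 1"
    "\<And>l m. 20 * m \<le> l \<Longrightarrow> \<exists>u v. \<forall>s t.
       norm (\<Sum>n<b ^ l. cis (2 * pi * (s * real n + t * real (digit_reverse b l n))))
       \<le> real b ^ l * (c ^ far_count b m (s * real ((b ^ 2 - 1) * b ^ u))
                      * c ^ far_count b m (t * real ((b ^ 2 - 1) * b ^ v)))"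
proof -
  define d where "d = 1 / (2 * real b ^ 10)"
  have "(1::real) < real b ^ 10" using b by (intro one_less_power) auto
  then have "1 / real b ^ 10 < 1" by (subst divide_less_eq_1_pos) linarith+
  then have d: "0 < d" "d < 1 / 2" using b by (auto simp: d_def)
  obtain c where c: "0 < c" "c < 1"
    and pair: "\<And>s t. \<not> near_int d (t - real b * s) \<Longrightarrow>
       norm (digit_phase_sum b s) * norm (digit_phase_sum b t) \<le> c * real b ^ 2"
    using digit_phase_sum_pair_saving[OF b d] by blast
  have b2: "real (b ^ 2 - 1) = real b ^ 2 - 1" using b by (simp add: of_nat_diff)
  show ?thesis
  proof (rule that[OF c])
    fix l m :: nat assume lm: "20 * m \<le> l"
    \<comment> \<open>The pairs for s and for t start at different powers of b: the unused common power is split off.\<close>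
    define u where "u = 10 * m"
    define v where "v = l - 2 - 10 * (m - 1)"
    show "\<exists>u v. \<forall>s t.
       norm (\<Sum>n<b ^ l. cis (2 * pi * (s * real n + t * real (digit_reverse b l n))))
       \<le> real b ^ l * (c ^ far_count b m (s * real ((b ^ 2 - 1) * b ^ u))
                      * c ^ far_count b m (t * real ((b ^ 2 - 1) * b ^ v)))"
    proof (intro exI allI)
      fix s t :: real
      define th where "th j = s * real b ^ j + t * real b ^ (l - 1 - j)" for j
      define y where "y i = (if i < m then t * real (b ^ 2 - 1) * real b ^ (l - 2 - 10 * i)
                       else s * real (b ^ 2 - 1) * real b ^ (10 * i))" for i
      define x :: "nat \<Rightarrow> nat" where "x i = of_bool (\<not> near_int d (y i))" for i
      define a where "a j = norm (digit_phase_sum b (th j))" for j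
      have pairs: "a (10 * i) * a (10 * i + 1) \<le> c ^ x i * real b ^ 2" if i: "i < 2 * m" for i
      proof (cases "near_int d (y i)")
        case True
        then have "a (10 * i) * a (10 * i + 1) \<le> real b * real b"
          unfolding a_def by (intro mult_mono norm_digit_phase_sum_le) auto
        then show ?thesis using True by (simp add: x_def power2_eq_square)
      next
        case False
        have il: "Suc (10 * i) < l" using i lm by linarith
        then have "l - Suc (10 * i) = Suc (l - 2 - 10 * i)" by simp
        then have p: "l - 1 - 10 * i = Suc (l - 2 - 10 * i)" "l - 1 - (10 * i + 1) = l - 2 - 10 * i" by auto
        show ?thesis
        proof (cases "i < m")
          case True
          have "th (10 * i + 1) - real b * th (10 * i) = - y i"
            using True by (simp only: th_def y_def p b2 if_True) (simp add: algebra_simps power2_eq_square)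
          then have "a (10 * i) * a (10 * i + 1) \<le> c * real b ^ 2"
            using pair[of "th (10 * i + 1)" "th (10 * i)"] False by (simp add: a_def)
          then show ?thesis using False by (simp add: x_def)
        next
          case ge: False
          have "th (10 * i) - real b * th (10 * i + 1) = - y i"
            using ge by (simp only: th_def y_def p b2 if_False) (simp add: algebra_simps power2_eq_square)
          then have "a (10 * i) * a (10 * i + 1) \<le> c * real b ^ 2"
            using pair[of "th (10 * i)" "th (10 * i + 1)"] False by (simp add: a_def mult.commute)
          then show ?thesis using False by (simp add: x_def)
        qed
      qed
      have a01: "0 \<le> a j" "a j \<le> real b" for j by (simp_all add: a_def norm_digit_phase_sum_le)
      have "(\<Sum>i<2 * m. x i) = (\<Sum>i<m. x i) + (\<Sum>i<m. x (m + i))"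
        by (simp only: mult_2 sum_lessThan_add)
      also have "(\<Sum>i<m. x (m + i)) = far_count b m (s * real ((b ^ 2 - 1) * b ^ u))"
        unfolding far_count_sum d_def[symmetric] x_def
        by (intro sum.cong refl arg_cong[where f = of_bool] arg_cong[where f = Not] arg_cong[where f = "near_int d"])
          (simp add: y_def u_def power_add mult_ac)
      \<comment> \<open>For t the powers of b decrease along the digits, hence the reflection.\<close>
      also have "(\<Sum>i<m. x i) = (\<Sum>i<m. x (m - Suc i))"
        by (rule sum.nat_diff_reindex[symmetric])
      also have "\<dots> = far_count b m (t * real ((b ^ 2 - 1) * b ^ v))"
        unfolding far_count_sum d_def[symmetric] x_def
      proof (intro sum.cong refl arg_cong[where f = of_bool] arg_cong[where f = Not] arg_cong[where f = "near_int d"])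
        fix i assume i: "i \<in> {..<m}"
        then have "l - 2 - 10 * (m - Suc i) = 10 * i + v" using lm by (auto simp: v_def)
        then show "y (m - Suc i) = real b ^ (10 * i) * (t * real ((b ^ 2 - 1) * b ^ v))"
          using i by (simp add: y_def power_add)
      qed
      finally have total: "(\<Sum>i<2 * m. x i) = far_count b m (t * real ((b ^ 2 - 1) * b ^ v))
          + far_count b m (s * real ((b ^ 2 - 1) * b ^ u))" .
      have "norm (\<Sum>n<b ^ l. cis (2 * pi * (s * real n + t * real (digit_reverse b l n)))) = (\<Prod>j<l. a j)"
        unfolding phase_sum_factorises[OF b] a_def th_def by (rule prod_norm[symmetric])
      also have "{..<l} = {..<10 * (2 * m)} \<union> {20 * m..<l}" using lm by auto
      also have "(\<Prod>j\<in>{..<10 * (2 * m)} \<union> {20 * m..<l}. a j) = (\<Prod>j<10 * (2 * m). a j) * (\<Prod>j=20 * m..<l. a j)"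
        by (rule prod.union_disjoint) auto
      also have "\<dots> \<le> (real b ^ (10 * (2 * m)) * c ^ (\<Sum>i<2 * m. x i)) * (\<Prod>j=20 * m..<l. real b)"
        using a01 b c by (intro mult_mono prod_blocks_le[OF a01 pairs] prod_mono prod_nonneg) auto
      also have "\<dots> = real b ^ (20 * m + (l - 20 * m)) * c ^ (\<Sum>i<2 * m. x i)"
        by (simp add: power_add)
      also have "20 * m + (l - 20 * m) = l" using lm by simp
      finally show "norm (\<Sum>n<b ^ l. cis (2 * pi * (s * real n + t * real (digit_reverse b l n))))
       \<le> real b ^ l * (c ^ far_count b m (s * real ((b ^ 2 - 1) * b ^ u))
                      * c ^ far_count b m (t * real ((b ^ 2 - 1) * b ^ v)))"
        unfolding total by (simp add: power_add mult_ac)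
    qed
  qed
qed

section \<open>Joint divisibility of an integer and its reversal\<close>

lemma sum_cis_multiples:
  fixes n r :: nat
  assumes "r > 0"
  shows "(\<Sum>h<r. cis (2 * pi * (real h / real r * real n))) = (if r dvd n then of_nat r else 0)"
proof -
  define w where "w = cis (2 * pi * (real n / real r))"
  have pow: "w ^ h = cis (2 * pi * (real h / real r * real n))" for h
    unfolding w_def Complex.DeMoivre by (rule arg_cong[where f = cis]) (simp add: field_simps)
  show ?thesis
  proof (cases "r dvd n")
    case True
    then obtain k where "n = r * k" by blast
    then have "w = cis (2 * pi * real k)" using assms by (simp add: w_def)
    then have "w = 1" by (metis cis_multiple_2pi Ints_of_nat)
    then show ?thesis using True by (simp only: pow[symmetric] power_one) simp
  next
    case False
    have "w \<noteq> 1"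
    proof
      assume "w = 1"
      then have "cos (2 * pi * (real n / real r)) = 1" by (simp add: w_def complex_eq_iff)
      then obtain k :: int where "2 * pi * (real n / real r) = of_int k * 2 * pi"
        using cos_one_2pi_int by blast
      then have "(2 * pi) * (real n / real r) = (2 * pi) * of_int k" by (simp only: mult_ac)
      then have "real n / real r = of_int k" by (subst (asm) mult_left_cancel) auto
      then have "real n = of_int k * real r" using assms by (simp add: field_simps)
      then have "int n = k * int r" by (metis of_int_eq_iff of_int_mult of_int_of_nat_eq)
      then have "int r dvd int n" by simp
      then show False using False by simp
    qed
    moreover have "w ^ r = cis (2 * pi * real n)" using assms by (simp add: pow)
    then have "w ^ r = 1" by (metis cis_multiple_2pi Ints_of_nat)
    ultimately show ?thesis
      using False by (simp only: pow[symmetric] if_False) (simp add: geometric_sum)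
  qed
qed

text \<open>
A unit permutes the residues and also the reduced residues; this removes dilations by \<open>b\<close> and by
\<open>b ^ 2 - 1\<close> from every sum over fractions with a fixed denominator.
\<close>
lemma mult_mod_permutes:
  fixes a r :: nat
  assumes "r > 0" "coprime a r"
  shows "bij_betw (\<lambda>h. h * a mod r) {..<r} {..<r}"
    and "bij_betw (\<lambda>h. h * a mod r) {h. h < r \<and> coprime h r} {h. h < r \<and> coprime h r}"
proof -
  have inj: "inj_on (\<lambda>h. h * a mod r) {..<r}"
  proof (rule inj_onI)
    fix x y assume xy: "x \<in> {..<r}" "y \<in> {..<r}" and eq: "x * a mod r = y * a mod r"
    then have "[x * a = y * a] (mod r)" by (simp add: cong_def)
    then have "[x = y] (mod r)" using assms(2) by (simp add: cong_mult_rcancel_nat)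
    then show "x = y" using xy by (simp add: cong_def)
  qed
  have "(\<lambda>h. h * a mod r) ` {..<r} = {..<r}"
    using inj assms by (intro endo_inj_surj) auto
  with inj show "bij_betw (\<lambda>h. h * a mod r) {..<r} {..<r}" by (simp add: bij_betw_def)
  have inj': "inj_on (\<lambda>h. h * a mod r) {h. h < r \<and> coprime h r}"
    by (rule inj_on_subset[OF inj]) auto
  have "(\<lambda>h. h * a mod r) ` {h. h < r \<and> coprime h r} = {h. h < r \<and> coprime h r}"
    using inj' assms by (intro endo_inj_surj) auto
  with inj' show "bij_betw (\<lambda>h. h * a mod r) {h. h < r \<and> coprime h r} {h. h < r \<and> coprime h r}"
    by (simp add: bij_betw_def)
qed

lemma far_count_add_int [simp]: "far_count b m (t + of_int k) = far_count b m t"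
proof -
  have "real b ^ i * (t + of_int k) = real b ^ i * t + of_int (int b ^ i * k)" for i
    by (simp add: algebra_simps)
  then show ?thesis unfolding far_count_def by (simp only: near_int_add_int)
qed

lemma far_count_mod:
  assumes "r > 0"
  shows "far_count b m (real (h * a mod r) / real r) = far_count b m (real h / real r * real a)"
proof -
  have "real (h * a) = real (h * a mod r) + real r * real (h * a div r)"
    by (metis mod_mult_div_eq of_nat_add of_nat_mult)
  then have "real h / real r * real a = (real (h * a mod r) + real r * real (h * a div r)) / real r"
    by simp
  also have "\<dots> = real (h * a mod r) / real r + of_int (int (h * a div r))"
    using assms by (simp add: add_divide_distrib)
  finally show ?thesis by (simp only: far_count_add_int)
qed

text \<open>
The bound for one coordinate, summed over all fractions of denominator \<open>r\<close>; the fraction 0 contributes 1.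
\<close>
definition far_sum :: "nat \<Rightarrow> real \<Rightarrow> nat \<Rightarrow> nat \<Rightarrow> real" where
  "far_sum b c m r = (\<Sum>h<r. c ^ far_count b m (real h / real r))"

lemma far_sum_dilate:
  assumes "r > 0" "coprime a r"
  shows "(\<Sum>h<r. c ^ far_count b m (real h / real r * real a)) = far_sum b c m r"
  unfolding far_sum_def
  using sum.reindex_bij_betw[OF mult_mod_permutes(1)[OF assms], of "\<lambda>h. c ^ far_count b m (real h / real r)"]
  by (simp add: far_count_mod[OF assms(1)])

lemma far_count_0: "far_count b m 0 = 0" if "b > 0"
  using that by (auto simp: far_count_def near_int_def intro!: exI[of _ 0])

lemma card_joint_multiples:
  fixes g :: "nat \<Rightarrow> nat"
  assumes r: "r > 0" and s: "s > 0"
  shows "of_nat (card {n. n < N \<and> r dvd n \<and> s dvd g n}) * (of_nat r * of_nat s)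
    = (\<Sum>h<r. \<Sum>k<s. \<Sum>n<N. cis (2 * pi * (real h / real r * real n + real k / real s * real (g n))))"
proof -
  have "(\<Sum>h<r. \<Sum>k<s. \<Sum>n<N. cis (2 * pi * (real h / real r * real n + real k / real s * real (g n))))
    = (\<Sum>h<r. \<Sum>k<s. \<Sum>n<N. cis (2 * pi * (real h / real r * real n)) * cis (2 * pi * (real k / real s * real (g n))))"
    by (simp add: cis_mult distrib_left)
  also have "\<dots> = (\<Sum>h<r. \<Sum>n<N. \<Sum>k<s. cis (2 * pi * (real h / real r * real n)) * cis (2 * pi * (real k / real s * real (g n))))"
    by (intro sum.cong[OF refl]) (rule sum.swap)
  also have "\<dots> = (\<Sum>n<N. \<Sum>h<r. \<Sum>k<s. cis (2 * pi * (real h / real r * real n)) * cis (2 * pi * (real k / real s * real (g n))))"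
    by (rule sum.swap)
  also have "\<dots> = (\<Sum>n<N. (if r dvd n then of_nat r else 0) * (if s dvd g n then of_nat s else 0))"
    by (simp only: sum_product[symmetric] sum_cis_multiples[OF r] sum_cis_multiples[OF s])
  also have "\<dots> = (\<Sum>n<N. if n \<in> {n. r dvd n \<and> s dvd g n} then of_nat r * of_nat s else 0)"
    by (intro sum.cong[OF refl]) auto
  also have "\<dots> = of_nat (card ({..<N} \<inter> {n. r dvd n \<and> s dvd g n})) * (of_nat r * of_nat s)"
    by (subst sum.inter_restrict[symmetric]) auto
  also have "{..<N} \<inter> {n. r dvd n \<and> s dvd g n} = {n. n < N \<and> r dvd n \<and> s dvd g n}" by auto
  finally show ?thesis ..
qed

text \<open>
The term \<open>h = k = 0\<close> of the orthogonality relation is the main term. Since the bound for the others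
factorises, they contribute a product of two sums, minus the 1 that belongs to the main term.
\<close>
lemma joint_multiples_discrepancy:
  assumes b: "b \<ge> 2" and r: "r > 0" "coprime (b * (b ^ 2 - 1)) r" and s: "s > 0" "coprime (b * (b ^ 2 - 1)) s"
    and c: "0 < c"
    and bound: "\<And>x y. norm (\<Sum>n<N. cis (2 * pi * (x * real n + y * real (g n))))
       \<le> real N * (c ^ far_count b m (x * real ((b ^ 2 - 1) * b ^ u))
                      * c ^ far_count b m (y * real ((b ^ 2 - 1) * b ^ v)))"
  shows "\<bar>real (card {n. n < N \<and> r dvd n \<and> s dvd g n}) - real N / (real r * real s)\<bar>
    \<le> real N / (real r * real s) * (far_sum b c m r * far_sum b c m s - 1)"
proof -
  define F where "F h k = (\<Sum>n<N. cis (2 * pi * (real h / real r * real n + real k / real s * real (g n))))" for h k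
  define G where "G h k = c ^ far_count b m (real h / real r * real ((b ^ 2 - 1) * b ^ u))
                      * c ^ far_count b m (real k / real s * real ((b ^ 2 - 1) * b ^ v))" for h k
  have FG: "norm (F h k) \<le> real N * G h k" for h k
    unfolding F_def G_def by (rule bound)
  have F0: "F 0 0 = of_nat N" by (simp add: F_def)
  have G0: "G 0 0 = 1" using b by (simp add: G_def far_count_0)
  have fin: "finite ({..<r} \<times> {..<s})" and zero: "(0, 0) \<in> {..<r} \<times> {..<s}" using r s by auto
  have "(\<Sum>(h, k)\<in>{..<r} \<times> {..<s}. G h k) = far_sum b c m r * far_sum b c m s"
  proof -
    have "coprime ((b ^ 2 - 1) * b ^ u) r" "coprime ((b ^ 2 - 1) * b ^ v) s" using r s by auto
    from far_sum_dilate[OF r(1) this(1)] far_sum_dilate[OF s(1) this(2)] show ?thesis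
      unfolding G_def by (simp only: sum.cartesian_product[symmetric] sum_product[symmetric])
  qed
  then have sumG: "(\<Sum>(h, k)\<in>{..<r} \<times> {..<s} - {(0, 0)}. G h k) = far_sum b c m r * far_sum b c m s - 1"
    using fin zero by (simp add: sum_diff1 G0)
  define K where "K = card {n. n < N \<and> r dvd n \<and> s dvd g n}"
  have "of_nat K * (of_nat r * of_nat s) = (\<Sum>(h, k)\<in>{..<r} \<times> {..<s}. F h k)"
    unfolding sum.cartesian_product[symmetric] F_def K_def by (rule card_joint_multiples[OF r(1) s(1)])
  then have "complex_of_real (real K * (real r * real s) - real N)
      = (\<Sum>(h, k)\<in>{..<r} \<times> {..<s} - {(0, 0)}. F h k)"
    using fin zero by (simp add: sum_diff1 F0)
  then have "\<bar>real K * (real r * real s) - real N\<bar> = norm (\<Sum>(h, k)\<in>{..<r} \<times> {..<s} - {(0, 0)}. F h k)"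
    by (metis norm_of_real real_norm_def)
  also have "\<dots> \<le> (\<Sum>(h, k)\<in>{..<r} \<times> {..<s} - {(0, 0)}. real N * G h k)"
    by (rule order_trans[OF norm_sum]) (auto intro!: sum_mono FG)
  also have "\<dots> = real N * (far_sum b c m r * far_sum b c m s - 1)"
    unfolding sumG[symmetric] sum_distrib_left by (intro sum.cong) auto
  finally have main: "\<bar>real K * (real r * real s) - real N\<bar> \<le> real N * (far_sum b c m r * far_sum b c m s - 1)" .
  have rs: "0 < real r * real s" using r s by simp
  have "real K - real N / (real r * real s) = (real K * (real r * real s) - real N) / (real r * real s)"
    using r s by (simp add: field_simps)
  then have "\<bar>real K - real N / (real r * real s)\<bar> = \<bar>real K * (real r * real s) - real N\<bar> / (real r * real s)"
    using rs by (metis abs_divide abs_of_pos)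
  also have "\<dots> \<le> real N * (far_sum b c m r * far_sum b c m s - 1) / (real r * real s)"
    using main rs by (intro divide_right_mono) auto
  finally show ?thesis by (simp add: K_def)
qed

section \<open>Sums over fractions of bounded denominator\<close>

text \<open>
Multiplication of \<open>B ^ i t\<close> by \<open>B\<close> turns the distance \<open>1 / (2 B)\<close> from \<open>z\<close> into \<open>1 / 2\<close> from \<open>B z\<close>, so
the integer part of \<open>B ^ (i + 1) t\<close> is \<open>B z\<close> or \<open>B z - 1\<close>; its residue modulo \<open>B\<close> is a digit of \<open>t\<close>.
\<close>
lemma near_int_digit:
  fixes b L i :: nat and t :: real
  assumes b: "b \<ge> 2" and t: "0 \<le> t" and i: "i < L"
    and near: "near_int (1 / (2 * real b ^ 10)) (real b ^ (10 * i) * t)"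
  shows "digit (b ^ 10) (nat \<lfloor>real b ^ (10 * L) * t\<rfloor>) (L - Suc i) \<in> {0, b ^ 10 - 1}"
proof -
  define B where "B = b ^ 10"
  have B: "B \<ge> 2" using b self_le_power[of b 10] by (simp add: B_def)
  obtain z :: int where z: "\<bar>real b ^ (10 * i) * t - of_int z\<bar> < 1 / (2 * real b ^ 10)"
    using near by (auto simp: near_int_def)
  define w where "w = \<lfloor>real B ^ Suc i * t\<rfloor>"
  have "real B ^ Suc i * t - of_int (int B * z) = real B * (real b ^ (10 * i) * t - of_int z)"
    by (simp add: B_def power_mult right_diff_distrib)
  then have "\<bar>real B ^ Suc i * t - of_int (int B * z)\<bar> = real B * \<bar>real b ^ (10 * i) * t - of_int z\<bar>"
    by (simp only: abs_mult abs_of_nat)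
  also have "\<dots> < real B * (1 / (2 * real B))"
    using z B b by (intro mult_strict_left_mono) (auto simp: B_def)
  finally have "\<bar>real B ^ Suc i * t - of_int (int B * z)\<bar> < 1 / 2" using B by simp
  then have "w = int B * z \<or> w = int B * z - 1" unfolding w_def by linarith
  then have w: "w mod int B = 0 \<or> w mod int B = int B - 1"
  proof
    assume "w = int B * z - 1"
    then have "w = (int B - 1) + int B * (z - 1)" by (simp add: algebra_simps)
    then have "w mod int B = (int B - 1) mod int B" by (metis mod_mult_self2)
    also have "\<dots> = int B - 1" using B by (intro mod_pos_pos_trivial) auto
    finally show ?thesis ..
  qed simp
  have "real b ^ (10 * L) * t / real_of_int (int B ^ (L - Suc i)) = real B ^ Suc i * t"
  proof -
    have "L = Suc i + (L - Suc i)" using i by simp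
    then have "real B ^ L = real B ^ Suc i * real B ^ (L - Suc i)" by (metis power_add)
    then show ?thesis using B by (simp add: B_def power_mult)
  qed
  then have "\<lfloor>real b ^ (10 * L) * t\<rfloor> div (int B ^ (L - Suc i)) = w"
    using floor_divide_real_eq_div[of "int B ^ (L - Suc i)" "real b ^ (10 * L) * t"] by (simp add: w_def)
  then have "int (nat \<lfloor>real b ^ (10 * L) * t\<rfloor> div B ^ (L - Suc i)) = w"
    using t by (simp add: zdiv_int)
  then have "int (digit B (nat \<lfloor>real b ^ (10 * L) * t\<rfloor>) (L - Suc i)) = w mod int B"
    unfolding digit_def by (simp add: zmod_int)
  then show ?thesis using w B unfolding B_def[symmetric] by force
qed

definition digit_weight :: "nat \<Rightarrow> real \<Rightarrow> nat \<Rightarrow> real" where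
  "digit_weight B q e = (if e \<in> {0, B - 1} then 1 else q)"

lemma sum_digit_weight_le:
  assumes "B \<ge> 2" "0 \<le> q" "q \<le> 1 / real B"
  shows "(\<Sum>e<B. digit_weight B q e) \<le> 3"
proof -
  have "(\<Sum>e<B. digit_weight B q e) \<le> (\<Sum>e<B. (if e = 0 then 1 else 0) + (if e = B - 1 then 1 else 0) + 1 / real B)"
    using assms by (intro sum_mono) (auto simp: digit_weight_def)
  also have "\<dots> = 3" using assms by (simp add: sum.distrib)
  finally show ?thesis .
qed

lemma sum_prod_digit_weight_le:
  assumes "B \<ge> 2" "0 \<le> q" "q \<le> 1 / real B"
  shows "(\<Sum>y<B ^ L. \<Prod>j<L. digit_weight B q (digit B y j)) \<le> 3 ^ L"
proof -
  have "(\<Sum>y<B ^ L. \<Prod>j<L. digit_weight B q (digit B y j)) = (\<Sum>e<B. digit_weight B q e) ^ L"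
    using assms(1) by (subst sum_prod_digits[where f = "\<lambda>_. digit_weight B q"]) auto
  also have "\<dots> \<le> 3 ^ L"
    using assms by (intro power_mono sum_digit_weight_le sum_nonneg) (auto simp: digit_weight_def)
  finally show ?thesis .
qed

lemma power_far_count_le_digit_weights:
  assumes b: "b \<ge> 2" and t: "0 \<le> t" and q: "0 \<le> q" "q \<le> 1"
  shows "q ^ far_count b L t \<le> (\<Prod>j<L. digit_weight (b ^ 10) q (digit (b ^ 10) (nat \<lfloor>real b ^ (10 * L) * t\<rfloor>) j))"
proof -
  have "q ^ far_count b L t = (\<Prod>i<L. q ^ of_bool (\<not> near_int (1 / (2 * real b ^ 10)) (real b ^ (10 * i) * t)))"
    by (simp only: far_count_sum power_sum)
  also have "\<dots> \<le> (\<Prod>i<L. digit_weight (b ^ 10) q (digit (b ^ 10) (nat \<lfloor>real b ^ (10 * L) * t\<rfloor>) (L - Suc i)))"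
  proof (rule prod_mono, safe)
    fix i assume "i < L"
    show "0 \<le> q ^ of_bool (\<not> near_int (1 / (2 * real b ^ 10)) (real b ^ (10 * i) * t))" using q by simp
    show "q ^ of_bool (\<not> near_int (1 / (2 * real b ^ 10)) (real b ^ (10 * i) * t))
      \<le> digit_weight (b ^ 10) q (digit (b ^ 10) (nat \<lfloor>real b ^ (10 * L) * t\<rfloor>) (L - Suc i))"
      using near_int_digit[OF b t \<open>i < L\<close>] q unfolding digit_weight_def by auto
  qed
  also have "\<dots> = (\<Prod>j<L. digit_weight (b ^ 10) q (digit (b ^ 10) (nat \<lfloor>real b ^ (10 * L) * t\<rfloor>) j))"
    by (rule prod.nat_diff_reindex)
  finally show ?thesis .
qed

text \<open>
Distinct fractions of denominators \<open>d\<close> and \<open>d'\<close> differ by at least \<open>1 / (d d')\<close>.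
\<close>
lemma floor_fraction_inj:
  assumes coprime: "coprime h d" "coprime h' d'" and d: "0 < d" "0 < d'"
    and small: "real d * real d' \<le> M"
    and eq: "\<lfloor>M * (real h / real d)\<rfloor> = \<lfloor>M * (real h' / real d')\<rfloor>"
  shows "d = d' \<and> h = h'"
proof -
  have "\<bar>M * (real h / real d) - M * (real h' / real d')\<bar> < 1" using eq by linarith
  moreover have "M * (real h / real d) - M * (real h' / real d')
     = M * (real h * real d' - real h' * real d) / (real d * real d')"
    using d by (simp add: field_simps)
  moreover have pos: "0 < real d * real d'" using d by simp
  ultimately have "M * \<bar>real h * real d' - real h' * real d\<bar> < real d * real d'"
    using small by (simp add: abs_mult)
  also have "\<dots> \<le> M * 1" using small by simp
  finally have "\<bar>real h * real d' - real h' * real d\<bar> < 1"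
    using pos small by (subst (asm) mult_less_cancel_left_pos) auto
  then have "real_of_int \<bar>int h * int d' - int h' * int d\<bar> < 1" by simp
  then have "\<bar>int h * int d' - int h' * int d\<bar> < 1" by (simp only: of_int_less_1_iff)
  then have eq: "h * d' = h' * d" by (simp flip: of_nat_mult)
  then have "d dvd d'" "d' dvd d"
    using coprime by (metis coprime_commute coprime_dvd_mult_right_iff dvd_triv_right)+
  then have "d = d'" by (rule dvd_antisym)
  then show ?thesis using eq d by simp
qed

text \<open>
Distinct fractions lie in distinct cells of length \<open>B ^ (- 2 k)\<close>, so the sum is at most the sum over
all strings of \<open>2 k\<close> base-\<open>B\<close> digits, which factorises into \<open>2 k\<close> factors of size at most 3: two
digits have weight 1, and the total weight of the others is at most 1.
\<close>
lemma sum_fractions_block_le: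
  assumes b: "b \<ge> 2" and q: "0 \<le> q" "q \<le> 1 / real b ^ 10"
    and D: "\<And>d. d \<in> D \<Longrightarrow> 0 < d \<and> d < b ^ (10 * k)"
  shows "(\<Sum>d\<in>D. \<Sum>h | h < d \<and> coprime h d. q ^ far_count b (2 * k) (real h / real d)) \<le> 9 ^ k"
proof -
  define X where "X = (SIGMA d:D. {h. h < d \<and> coprime h d})"
  define cell where "cell = (\<lambda>(d, h). nat \<lfloor>real b ^ (10 * (2 * k)) * (real h / real d)\<rfloor>)"
  define g where "g y = (\<Prod>j<2 * k. digit_weight (b ^ 10) q (digit (b ^ 10) y j))" for y
  have "D \<subseteq> {..<b ^ (10 * k)}" using D by blast
  then have fin: "finite D" by (rule finite_subset) simp
  have B: "b ^ 10 \<ge> 2" using b self_le_power[of b 10] by simp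
  have "1 / real b ^ 10 \<le> 1" using b by simp
  then have q1: "q \<le> 1" using q by linarith
  have g0: "0 \<le> g y" for y unfolding g_def using q by (intro prod_nonneg) (auto simp: digit_weight_def)
  have inj: "inj_on cell X"
  proof (rule inj_onI)
    fix x x' assume "x \<in> X" "x' \<in> X" and eq: "cell x = cell x'"
    then obtain d h d' h' where x: "x = (d, h)" "d \<in> D" "coprime h d" and x': "x' = (d', h')" "d' \<in> D" "coprime h' d'"
      by (auto simp: X_def)
    have "real d * real d' \<le> real (b ^ (10 * k)) * real (b ^ (10 * k))"
      using D[OF x(2)] D[OF x'(2)] by (intro mult_mono) (auto simp del: of_nat_power)
    also have "\<dots> = real b ^ (10 * (2 * k))" by (simp add: power_add[symmetric])
    finally have "real d * real d' \<le> real b ^ (10 * (2 * k))" .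
    moreover have "\<lfloor>real b ^ (10 * (2 * k)) * (real h / real d)\<rfloor> = \<lfloor>real b ^ (10 * (2 * k)) * (real h' / real d')\<rfloor>"
      using eq unfolding cell_def x x' by (simp add: nat_eq_iff)
    ultimately have "d = d' \<and> h = h'"
      using floor_fraction_inj[OF x(3) x'(3)] D[OF x(2)] D[OF x'(2)] by blast
    then show "x = x'" by (simp add: x x')
  qed
  have cell_less: "cell x < (b ^ 10) ^ (2 * k)" if "x \<in> X" for x
  proof -
    obtain d h where x: "x = (d, h)" by (cases x)
    then have "h < d" using that by (auto simp: X_def)
    then have "real b ^ (10 * (2 * k)) * (real h / real d) < real b ^ (10 * (2 * k)) * 1"
      using b by (intro mult_strict_left_mono) auto
    then have "\<lfloor>real b ^ (10 * (2 * k)) * (real h / real d)\<rfloor> < int ((b ^ 10) ^ (2 * k))"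
      by (simp add: floor_less_iff power_mult)
    then show ?thesis using b by (simp add: cell_def x nat_less_iff)
  qed
  have "(\<Sum>d\<in>D. \<Sum>h | h < d \<and> coprime h d. q ^ far_count b (2 * k) (real h / real d))
      = (\<Sum>(d, h)\<in>X. q ^ far_count b (2 * k) (real h / real d))"
    unfolding X_def using fin by (intro sum.Sigma) auto
  also have "\<dots> \<le> (\<Sum>x\<in>X. g (cell x))"
  proof (rule sum_mono)
    fix x :: "nat \<times> nat"
    obtain d h where x: "x = (d, h)" by (cases x)
    have "0 \<le> real h / real d" by simp
    from power_far_count_le_digit_weights[OF b this q(1) q1, of "2 * k"]
    show "(case x of (d, h) \<Rightarrow> q ^ far_count b (2 * k) (real h / real d)) \<le> g (cell x)"
      by (simp only: x g_def cell_def prod.case)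
  qed
  also have "\<dots> = (\<Sum>y\<in>cell ` X. g y)" using inj by (simp add: sum.reindex)
  also have "\<dots> \<le> (\<Sum>y<(b ^ 10) ^ (2 * k). g y)"
    using cell_less g0 by (intro sum_mono2) auto
  also have "\<dots> \<le> 3 ^ (2 * k)"
    unfolding g_def using B q by (intro sum_prod_digit_weight_le) auto
  also have "(3::real) ^ (2 * k) = 9 ^ k" by (simp add: power_mult)
  finally show ?thesis .
qed

text \<open>
Otherwise all multiples \<open>B ^ i h / d\<close>, \<open>i < L\<close>, would be near integers. The distances then grow
exactly by the factor \<open>B\<close> at each step, so \<open>h / d\<close> would be closer to an integer than \<open>1 / d\<close>.
\<close>
lemma far_count_pos:
  assumes b: "b \<ge> 2" and d: "0 < d" "\<not> d dvd h" "d \<le> b ^ (10 * L)"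
  shows "1 \<le> far_count b L (real h / real d)"
proof (rule ccontr)
  define B where "B = b ^ 10"
  have B: "B \<ge> 2" using b self_le_power[of b 10] by (simp add: B_def)
  define t where "t = real h / real d"
  assume "\<not> 1 \<le> far_count b L (real h / real d)"
  then have "{i. i < L \<and> \<not> near_int (1 / (2 * real b ^ 10)) (real b ^ (10 * i) * t)} = {}"
    by (simp add: far_count_def t_def not_le)
  then have near: "near_int (1 / (2 * real B)) (real B ^ i * t)" if "i < L" for i
    using that by (auto simp: B_def power_mult)
  have "L \<noteq> 0"
  proof
    assume "L = 0"
    then have "d = 1" using d by simp
    then show False using d by simp
  qed
  then obtain L' where L': "L = Suc L'" by (cases L) auto
  from near[of 0] L' obtain z :: int where z: "\<bar>t - of_int z\<bar> < 1 / (2 * real B)"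
    by (auto simp: near_int_def)
  have small: "real B ^ i * \<bar>t - of_int z\<bar> < 1 / (2 * real B)" if "i < L" for i
    using that
  proof (induction i)
    case (Suc i)
    have "real B ^ Suc i * \<bar>t - of_int z\<bar> = real B * (real B ^ i * \<bar>t - of_int z\<bar>)" by simp
    also have "\<dots> < real B * (1 / (2 * real B))" using Suc B by (intro mult_strict_left_mono) auto
    finally have half: "real B ^ Suc i * \<bar>t - of_int z\<bar> < 1 / 2" using B by simp
    obtain y :: int where y: "\<bar>real B ^ Suc i * t - of_int y\<bar> < 1 / (2 * real B)"
      using near[of "Suc i"] Suc by (auto simp: near_int_def)
    have "1 / (2 * real B) \<le> 1 / 4" using B by (simp add: field_simps)
    moreover have "real B ^ Suc i * t - of_int (int B ^ Suc i * z) = real B ^ Suc i * (t - of_int z)"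
      by (simp add: right_diff_distrib)
    then have "\<bar>real B ^ Suc i * t - of_int (int B ^ Suc i * z)\<bar> = real B ^ Suc i * \<bar>t - of_int z\<bar>"
      by (simp only: abs_mult power_abs abs_of_nat)
    ultimately have "\<bar>real_of_int y - of_int (int B ^ Suc i * z)\<bar> < 1"
      using y half by linarith
    then have "y = int B ^ Suc i * z" by linarith
    then show ?case using y \<open>\<bar>real B ^ Suc i * t - of_int (int B ^ Suc i * z)\<bar> = _\<close> by simp
  qed (use z in simp)
  have "real B * (real B ^ L' * \<bar>t - of_int z\<bar>) < real B * (1 / (2 * real B))"
    using small[of L'] L' B by (intro mult_strict_left_mono) auto
  then have "real B ^ L * \<bar>t - of_int z\<bar> < 1 / 2" using B L' by (simp add: mult.assoc)
  moreover have "real d \<le> real B ^ L" using d(3) by (simp add: B_def power_mult flip: of_nat_power)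
  then have "real d * \<bar>t - of_int z\<bar> \<le> real B ^ L * \<bar>t - of_int z\<bar>" by (intro mult_right_mono) auto
  moreover have "real d * \<bar>t - of_int z\<bar> = \<bar>real_of_int (int h - int d * z)\<bar>"
  proof -
    have "real d * \<bar>t - of_int z\<bar> = \<bar>real d * (t - of_int z)\<bar>" by (simp add: abs_mult)
    then show ?thesis using d by (simp add: t_def right_diff_distrib)
  qed
  ultimately have "\<bar>real_of_int (int h - int d * z)\<bar> < 1" by linarith
  then have "int h = int d * z" by linarith
  then have "int d dvd int h" by simp
  then show False using d by simp
qed

lemma far_count_mono: "m \<le> m' \<Longrightarrow> far_count b m t \<le> far_count b m' t"
  unfolding far_count_def by (intro card_mono) auto

lemma far_count_blocks:
  "far_count b (x * L) t = (\<Sum>k<x. far_count b L (real b ^ (10 * (L * k)) * t))"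
proof -
  define f where "f i = (of_bool (\<not> near_int (1 / (2 * real b ^ 10)) (real b ^ (10 * i) * t)) :: nat)" for i
  have "far_count b (x * L) t = (\<Sum>k<x. \<Sum>i = k * L..<k * L + L. f i)"
    by (simp only: far_count_sum f_def sum.nat_group)
  also have "\<dots> = (\<Sum>k<x. \<Sum>i<L. f (i + k * L))"
  proof (rule sum.cong[OF refl])
    fix k
    show "(\<Sum>i = k * L..<k * L + L. f i) = (\<Sum>i<L. f (i + k * L))"
      by (rule sum.reindex_bij_witness[where i = "\<lambda>n. n + k * L" and j = "\<lambda>n. n - k * L"]) auto
  qed
  also have "\<dots> = (\<Sum>k<x. far_count b L (real b ^ (10 * (L * k)) * t))"
    unfolding far_count_sum f_def
    by (intro sum.cong refl arg_cong[where f = of_bool] arg_cong[where f = Not] arg_cong2[where f = near_int])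
      (simp add: distrib_left power_add mult_ac)
  finally show ?thesis .
qed

text \<open>
Replaces Hoelder's inequality for a product over \<open>x\<close> blocks. The block with the smallest count is a
lower bound for all; half of the total exponent pays for \<open>sqrt c ^ x\<close> because every count is
positive, the other half raises \<open>c\<close> to the power \<open>K\<close> in the smallest block.
\<close>
lemma power_sum_le_pigeonhole:
  fixes n :: "nat \<Rightarrow> nat" and c :: real
  assumes c: "0 < c" "c < 1" and n: "\<And>k. k < x \<Longrightarrow> 1 \<le> n k" and x: "2 * K \<le> x" "0 < x"
  shows "c ^ (\<Sum>k<x. n k) \<le> sqrt c ^ x * (\<Sum>k<x. (c ^ K) ^ n k)"
proof -
  define M where "M = Min (n ` {..<x})"
  have "M \<in> n ` {..<x}" unfolding M_def using x by (intro Min_in) auto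
  then obtain k where k: "k < x" "M = n k" by auto
  have M: "M \<le> n j" if "j < x" for j unfolding M_def using that by (intro Min_le) auto
  have "x * M \<le> (\<Sum>k<x. n k)" using sum_bounded_below[of "{..<x}" M n] M by simp
  moreover have "x \<le> x * M" using n k by simp
  moreover have "2 * K * M \<le> x * M" using x by simp
  ultimately have "x + 2 * K * M \<le> 2 * (\<Sum>k<x. n k)" by linarith
  then have "sqrt c ^ (2 * (\<Sum>k<x. n k)) \<le> sqrt c ^ (x + 2 * K * M)"
    using c by (intro power_decreasing) auto
  also have "sqrt c ^ (2 * (\<Sum>k<x. n k)) = c ^ (\<Sum>k<x. n k)" using c by (simp add: power_mult)
  also have "sqrt c ^ (x + 2 * K * M) = sqrt c ^ x * (c ^ K) ^ n k"
    using c k by (simp add: power_add power_mult)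
  also have "\<dots> \<le> sqrt c ^ x * (\<Sum>k<x. (c ^ K) ^ n k)"
    using c k by (intro mult_left_mono member_le_sum[where f = "\<lambda>k. (c ^ K) ^ n k"]) auto
  finally show ?thesis .
qed

text \<open>
The part of \<open>far_sum\<close> that comes from reduced fractions of exact denominator \<open>d\<close>.
\<close>
definition far_sum_reduced :: "nat \<Rightarrow> real \<Rightarrow> nat \<Rightarrow> nat \<Rightarrow> real" where
  "far_sum_reduced b c m d = (\<Sum>h | h < d \<and> coprime h d. c ^ far_count b m (real h / real d))"

text \<open>
The \<open>x\<close> blocks of length \<open>2 k\<close> differ by dilations by powers of \<open>b\<close>, which permute the reduced
fractions of each denominator. So each block contributes the same sum as the first one.
\<close>
proposition far_sum_reduced_scale:
  assumes b: "b \<ge> 2" and c: "0 < c" "c < 1" and K: "c ^ K \<le> 1 / real b ^ 10"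
    and D: "\<And>d. d \<in> D \<Longrightarrow> 1 < d \<and> d < b ^ (10 * k) \<and> coprime b d"
    and x: "x * (2 * k) \<le> m" "2 * K \<le> x" "0 < x"
  shows "(\<Sum>d\<in>D. far_sum_reduced b c m d) \<le> sqrt c ^ x * (real x * 9 ^ k)"
proof -
  define L where "L = 2 * k"
  define a where "a j = b ^ (10 * (L * j))" for j
  have perm: "(\<Sum>h | h < d \<and> coprime h d. (c ^ K) ^ far_count b L (real h / real d * real (a j)))
      = (\<Sum>h | h < d \<and> coprime h d. (c ^ K) ^ far_count b L (real h / real d))" if "d \<in> D" for d j
  proof -
    have "0 < d" "coprime (a j) d" using D[OF that] by (auto simp: a_def)
    from sum.reindex_bij_betw[OF mult_mod_permutes(2)[OF this], of "\<lambda>h. (c ^ K) ^ far_count b L (real h / real d)"]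
    show ?thesis by (simp add: far_count_mod[OF \<open>0 < d\<close>])
  qed
  have point: "c ^ far_count b m (real h / real d)
      \<le> sqrt c ^ x * (\<Sum>j<x. (c ^ K) ^ far_count b L (real h / real d * real (a j)))"
    if d: "d \<in> D" and h: "coprime h d" for d h
  proof -
    have "c ^ far_count b m (real h / real d) \<le> c ^ far_count b (x * L) (real h / real d)"
      using c x by (intro power_decreasing far_count_mono) (auto simp: L_def)
    also have "\<dots> = c ^ (\<Sum>j<x. far_count b L (real h / real d * real (a j)))"
      by (simp only: far_count_blocks a_def of_nat_power mult.commute[of "real b ^ _" "real h / real d"])
    also have "\<dots> \<le> sqrt c ^ x * (\<Sum>j<x. (c ^ K) ^ far_count b L (real h / real d * real (a j)))"
    proof (rule power_sum_le_pigeonhole[OF c _ x(2,3)])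
      fix j
      have "b ^ (10 * k) \<le> b ^ (10 * L)" using b by (intro power_increasing) (auto simp: L_def)
      then have "d \<le> b ^ (10 * L)" using D[OF d] by simp
      moreover have "coprime d (h * a j)" using h D[OF d] by (simp add: a_def coprime_commute)
      then have "\<not> d dvd h * a j" using D[OF d] coprime_absorb_left by (metis less_numeral_extra(4) nat_dvd_1_iff_1)
      ultimately show "1 \<le> far_count b L (real h / real d * real (a j))"
        using far_count_pos[OF b, of d "h * a j" L] D[OF d] by simp
    qed
    finally show ?thesis .
  qed
  have "(\<Sum>d\<in>D. far_sum_reduced b c m d)
     \<le> (\<Sum>d\<in>D. \<Sum>h | h < d \<and> coprime h d. sqrt c ^ x * (\<Sum>j<x. (c ^ K) ^ far_count b L (real h / real d * real (a j))))"
    unfolding far_sum_reduced_def using point by (intro sum_mono) auto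
  also have "\<dots> = sqrt c ^ x * (\<Sum>d\<in>D. \<Sum>h | h < d \<and> coprime h d. \<Sum>j<x. (c ^ K) ^ far_count b L (real h / real d * real (a j)))"
    by (simp add: sum_distrib_left)
  also have "(\<Sum>d\<in>D. \<Sum>h | h < d \<and> coprime h d. \<Sum>j<x. (c ^ K) ^ far_count b L (real h / real d * real (a j)))
     = (\<Sum>d\<in>D. \<Sum>j<x. \<Sum>h | h < d \<and> coprime h d. (c ^ K) ^ far_count b L (real h / real d * real (a j)))"
    by (rule sum.cong[OF refl]) (rule sum.swap)
  also have "\<dots> = (\<Sum>d\<in>D. real x * (\<Sum>h | h < d \<and> coprime h d. (c ^ K) ^ far_count b L (real h / real d)))"
    by (rule sum.cong[OF refl]) (simp only: perm, simp)
  also have "\<dots> = real x * (\<Sum>d\<in>D. \<Sum>h | h < d \<and> coprime h d. (c ^ K) ^ far_count b L (real h / real d))"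
    by (simp add: sum_distrib_left)
  also have "\<dots> \<le> real x * 9 ^ k"
    unfolding L_def using b c K D by (intro mult_left_mono sum_fractions_block_le) force+
  finally show ?thesis using c by (simp add: mult_left_mono)
qed

lemma power_times_geometric_bounded:
  fixes q :: real
  assumes q: "0 \<le> q" "q < 1" and A: "0 < A"
  obtains C where "0 < C" "\<And>n. real n ^ A * q ^ n \<le> C"
proof -
  define r where "r = root A q"
  have r: "0 \<le> r" "r < 1" "r ^ A = q" using q A by (auto simp: r_def)
  have "(\<lambda>n. real n * r ^ n) \<longlonglongrightarrow> 0" using r by (intro powser_times_n_limit_0) auto
  then have "Bseq (\<lambda>n. real n * r ^ n)" using convergentI convergent_imp_Bseq by blast
  then obtain C where C: "0 < C" "\<And>n. norm (real n * r ^ n) \<le> C" by (auto elim: BseqE)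
  show ?thesis
  proof (rule that[of "C ^ A"])
    fix n
    have "real n ^ A * q ^ n = (real n * r ^ n) ^ A"
      unfolding r(3)[symmetric] by (simp add: power_mult_distrib mult.commute flip: power_mult)
    also have "\<dots> \<le> C ^ A" using C(2)[of n] r by (intro power_mono) auto
    finally show "real n ^ A * q ^ n \<le> C ^ A" .
  qed (use C in auto)
qed

lemma sum_half_powers_le: "(\<Sum>k=1..M. (1 / 2 :: real) ^ k) \<le> 1"
proof -
  have "(\<Sum>k=1..M. (1 / 2 :: real) ^ k) = 1 - (1 / 2) ^ M" by (induction M) auto
  then show ?thesis by simp
qed

text \<open>
On the scale \<open>B ^ (k - 1) \<le> d < B ^ k\<close> the sum is at most \<open>sqrt c ^ x * x * 9 ^ k\<close> with \<open>x\<close> about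
\<open>m / (2 k)\<close>, against a weight of order \<open>b ^ (5 k) \<ge> 32 ^ k\<close>. Since \<open>m\<close> is at most \<open>2 k (x + 1)\<close>, the
factor \<open>m ^ 8\<close> is absorbed by \<open>sqrt c ^ x\<close> and \<open>(9 / 16) ^ k\<close>, and \<open>2 ^ (- k)\<close> is left for the
summation over \<open>k\<close>. The exponent 8 is what the sieve needs: a factor of order \<open>m ^ 6\<close> is lost there,
and a saving of order \<open>m ^ 2\<close> has to remain.
\<close>
proposition far_sum_reduced_total:
  assumes b: "b \<ge> 2" and c: "0 < c" "c < 1" and K: "0 < K" "c ^ K \<le> 1 / real b ^ 10"
  obtains C where "0 < C"
    "\<And>m M D. 4 * K * M \<le> m \<Longrightarrow> (\<And>d. d \<in> D \<Longrightarrow> 1 < d \<and> d < b ^ (10 * M) \<and> coprime b d) \<Longrightarrow>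
       (\<Sum>d\<in>D. far_sum_reduced b c m d / sqrt (real d)) * real m ^ 8 \<le> C"
proof -
  define s where "s = sqrt c"
  have s: "0 < s" "s < 1" using c by (auto simp: s_def)
  obtain C1 where C1: "0 < C1" "\<And>n. real n ^ 9 * s ^ n \<le> C1"
    using power_times_geometric_bounded[of s 9] s by auto
  obtain C2 where C2: "0 < C2" "\<And>n. real n ^ 8 * (9 / 16) ^ n \<le> C2"
    using power_times_geometric_bounded[of "9 / 16" 8] by auto
  define C where "C = C1 / s * (256 * real b ^ 5 * C2)"
  have C0: "0 < C" using C1 C2 s b by (simp add: C_def)
  show ?thesis
  proof (rule that[OF C0])
    fix m M :: nat and D :: "nat set"
    assume m: "4 * K * M \<le> m" and D: "\<And>d. d \<in> D \<Longrightarrow> 1 < d \<and> d < b ^ (10 * M) \<and> coprime b d"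
    have "D \<subseteq> {..<b ^ (10 * M)}" using D by blast
    then have fin: "finite D" by (rule finite_subset) simp
    define scale where "scale d = (LEAST k. d < b ^ (10 * k))" for d
    have scale: "scale d \<in> {1..M}" "d < b ^ (10 * scale d)" "b ^ (10 * (scale d - 1)) \<le> d" if "d \<in> D" for d
    proof -
      show less: "d < b ^ (10 * scale d)" 
        unfolding scale_def using D[OF that]
        by (intro LeastI[where P = "\<lambda>k. d < b ^ (10 * k)" and k = M]) auto
      have "scale d \<noteq> 0"
      proof
        assume "scale d = 0"
        then have "d < 1" using less by simp
        then show False using D[OF that] by simp
      qed
      moreover have "scale d \<le> M" 
        unfolding scale_def using D[OF that]
        by (intro Least_le[where P = "\<lambda>k. d < b ^ (10 * k)"]) auto
      ultimately show "scale d \<in> {1..M}" by simp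
      have "scale d - 1 < scale d" using \<open>scale d \<noteq> 0\<close> by simp
      then have "\<not> d < b ^ (10 * (scale d - 1))"
        unfolding scale_def by (rule not_less_Least[where P = "\<lambda>k. d < b ^ (10 * k)"])
      then show "b ^ (10 * (scale d - 1)) \<le> d" by simp
    qed
    define T where "T k = (\<Sum>d | d \<in> D \<and> scale d = k. far_sum_reduced b c m d / sqrt (real d))" for k
    have term_le: "T k * real m ^ 8 \<le> C * (1 / 2) ^ k" if k: "k \<in> {1..M}" for k
    proof -
      define x where "x = m div (2 * k)"
      have k0: "0 < k" using k by simp
      have "2 * K * (2 * k) \<le> 4 * K * M" using k by simp
      then have "2 * K * (2 * k) \<le> m" using m by linarith
      then have x2K: "2 * K \<le> x" using k0 by (simp add: x_def less_eq_div_iff_mult_less_eq)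
      have x0: "0 < x" using x2K K by linarith
      have xm: "x * (2 * k) \<le> m" by (simp add: x_def)
      have "m < 2 * k + 2 * k * (m div (2 * k))" using k0 by (intro dividend_less_times_div) simp
      then have "real m \<le> real (2 * k * (x + 1))" unfolding of_nat_le_iff by (simp add: x_def distrib_left)
      then have mle: "real m \<le> 2 * real k * real (x + 1)" by (simp add: distrib_left)
      have "T k \<le> (\<Sum>d | d \<in> D \<and> scale d = k. far_sum_reduced b c m d / real b ^ (5 * (k - 1)))"
        unfolding T_def
      proof (rule sum_mono)
        fix d assume "d \<in> {d \<in> D. scale d = k}"
        then have d: "b ^ (10 * (k - 1)) \<le> d" using scale(3)[of d] by auto
        have "real b ^ (5 * (k - 1)) = sqrt (real (b ^ (10 * (k - 1))))"
          by (rule real_sqrt_unique[symmetric]) (simp_all flip: power_mult)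
        also have "\<dots> \<le> sqrt (real d)" using d by (subst real_sqrt_le_iff) (simp only: of_nat_le_iff)
        finally have "real b ^ (5 * (k - 1)) \<le> sqrt (real d)" .
        then show "far_sum_reduced b c m d / sqrt (real d) \<le> far_sum_reduced b c m d / real b ^ (5 * (k - 1))"
          using b c D[of d] \<open>d \<in> {d \<in> D. scale d = k}\<close>
          by (intro divide_left_mono) (auto simp: far_sum_reduced_def intro!: sum_nonneg mult_pos_pos)
      qed
      also have "\<dots> = (\<Sum>d | d \<in> D \<and> scale d = k. far_sum_reduced b c m d) / real b ^ (5 * (k - 1))"
        by (simp add: sum_divide_distrib)
      also have "\<dots> \<le> (s ^ x * (real x * 9 ^ k)) / real b ^ (5 * (k - 1))"
        unfolding s_def using D scale b
        by (intro divide_right_mono far_sum_reduced_scale[OF b c K(2) _ xm x2K x0]) auto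
      also have "\<dots> = s ^ x * real x * real b ^ 5 * (9 ^ k / (real b ^ 5) ^ k)"
      proof -
        have "(real b ^ 5) ^ k = real b ^ 5 * real b ^ (5 * (k - 1))"
          using k0 by (cases k) (auto simp: power_mult)
        then show ?thesis using b by (simp add: field_simps)
      qed
      also have "\<dots> \<le> s ^ x * real x * real b ^ 5 * ((9 / 16) ^ k * (1 / 2) ^ k)"
      proof (intro mult_left_mono)
        have "(2::real) ^ 5 \<le> real b ^ 5" using b by (intro power_mono) auto
        then have "9 ^ k / (real b ^ 5) ^ k \<le> 9 ^ k / (32::real) ^ k"
          using b by (intro divide_left_mono power_mono) auto
        also have "\<dots> = (9 / 16) ^ k * (1 / 2) ^ k" by (simp flip: power_divide power_mult_distrib)
        finally show "9 ^ k / (real b ^ 5) ^ k \<le> (9 / 16) ^ k * (1 / 2) ^ k" .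
      qed (use s in auto)
      finally have Tk: "T k \<le> s ^ x * real x * real b ^ 5 * ((9 / 16) ^ k * (1 / 2) ^ k)" .
      have "T k * real m ^ 8 \<le> (s ^ x * real x * real b ^ 5 * ((9 / 16) ^ k * (1 / 2) ^ k)) * (2 * real k * real (x + 1)) ^ 8"
        using Tk mle s by (intro mult_mono power_mono) auto
      also have "\<dots> = (real x * real (x + 1) ^ 8 * s ^ x) * (256 * real b ^ 5 * (real k ^ 8 * (9 / 16) ^ k)) * (1 / 2) ^ k"
        by (simp only: power_mult_distrib) (simp add: mult_ac)
      also have "\<dots> \<le> (C1 / s) * (256 * real b ^ 5 * C2) * (1 / 2) ^ k"
      proof (intro mult_right_mono mult_mono mult_left_mono)
        have "real x * real (x + 1) ^ 8 * s ^ x \<le> real (x + 1) * real (x + 1) ^ 8 * s ^ x"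
          using s by (intro mult_right_mono) auto
        also have "\<dots> = (real (x + 1) ^ 9 * s ^ (x + 1)) / s" using s by (simp add: eval_nat_numeral)
        also have "\<dots> \<le> C1 / s" using C1(2)[of "x + 1"] s by (intro divide_right_mono) auto
        finally show "real x * real (x + 1) ^ 8 * s ^ x \<le> C1 / s" .
        show "real k ^ 8 * (9 / 16) ^ k \<le> C2" by (rule C2)
      qed (use s C1 in auto)
      finally show ?thesis by (simp add: C_def)
    qed
    have "(\<Sum>d\<in>D. far_sum_reduced b c m d / sqrt (real d)) = (\<Sum>k=1..M. T k)"
      unfolding T_def using fin scale(1) by (intro sum.group[symmetric]) auto
    then have "(\<Sum>d\<in>D. far_sum_reduced b c m d / sqrt (real d)) * real m ^ 8 = (\<Sum>k=1..M. T k * real m ^ 8)"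
      by (simp add: sum_distrib_right)
    also have "\<dots> \<le> (\<Sum>k=1..M. C * (1 / 2) ^ k)" by (intro sum_mono term_le)
    also have "\<dots> = C * (\<Sum>k=1..M. (1 / 2) ^ k)" by (simp add: sum_distrib_left)
    also have "\<dots> \<le> C * 1" using C0 by (intro mult_left_mono sum_half_powers_le) auto
    finally show "(\<Sum>d\<in>D. far_sum_reduced b c m d / sqrt (real d)) * real m ^ 8 \<le> C" by simp
  qed
qed

section \<open>Selberg sieve over sets of primes\<close>

lemma prod_primes_dvd_iff:
  fixes A :: "nat set"
  assumes "finite A" "\<And>p. p \<in> A \<Longrightarrow> prime p"
  shows "\<Prod>A dvd n \<longleftrightarrow> (\<forall>p\<in>A. p dvd n)"
  using assms
proof (induction A rule: finite_induct)
  case (insert p A)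
  have "coprime p (\<Prod>A)"
    using insert by (intro prod_coprime_right) (auto intro!: primes_coprime)
  moreover have "\<Prod>(insert p A) = p * \<Prod>A" using insert.hyps by simp
  ultimately have "\<Prod>(insert p A) dvd n \<longleftrightarrow> p dvd n \<and> \<Prod>A dvd n"
    by (metis divides_mult dvd_mult_left dvd_mult_right)
  then show ?case using insert by simp
qed simp

lemma prime_factors_prod_primes:
  fixes A :: "nat set"
  assumes "finite A" "\<And>p. p \<in> A \<Longrightarrow> prime p"
  shows "prime_factors (\<Prod>A) = A"
proof -
  have "0 \<notin> (\<lambda>p. p) ` A" using assms(2)[of 0] by auto
  then have "prime_factors (\<Prod>A) = \<Union>((prime_factors \<circ> (\<lambda>p. p)) ` A)"
    using assms by (intro prime_factors_prod) auto
  also have "\<dots> = A" using assms by (auto simp: prime_prime_factors)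
  finally show ?thesis .
qed

lemma prod_prime_factors_squarefree:
  fixes n :: nat
  assumes "squarefree n"
  shows "\<Prod>(prime_factors n) = n"
proof -
  have n: "n \<noteq> 0" using assms by (intro notI) simp
  have "n = (\<Prod>p\<in>prime_factors n. p ^ multiplicity p n)" using prod_prime_factors[OF n] by simp
  also have "\<dots> = (\<Prod>p\<in>prime_factors n. p)"
    using assms n by (intro prod.cong) (auto simp: squarefree_factorial_semiring')
  finally show ?thesis by simp
qed

lemma squarefree_prod_primes:
  fixes A :: "nat set"
  assumes "\<And>p. p \<in> A \<Longrightarrow> prime p"
  shows "squarefree (\<Prod>A)"
  using assms by (intro squarefree_prod_coprime) (auto intro!: primes_coprime squarefree_prime)

text \<open>
Moebius inversion on the lattice of subsets, read off from the expansion of the product of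
\<open>(- 1) + 1\<close> over \<open>B - E\<close>.
\<close>
lemma sum_signs_between:
  assumes B: "finite B" and E: "E \<subseteq> B"
  shows "(\<Sum>A | E \<subseteq> A \<and> A \<subseteq> B. (- 1) ^ card A) = (if E = B then (- 1) ^ card E else 0 :: real)"
proof -
  have fin: "finite E" "finite (B - E)" using assms finite_subset by auto
  have "(\<Sum>A | E \<subseteq> A \<and> A \<subseteq> B. (- 1) ^ card A) = (\<Sum>X\<in>Pow (B - E). (- 1) ^ card E * (- 1 :: real) ^ card X)"
  proof (rule sum.reindex_bij_witness[where i = "\<lambda>X. E \<union> X" and j = "\<lambda>A. A - E"])
    fix A assume A: "A \<in> {A. E \<subseteq> A \<and> A \<subseteq> B}"
    then have "finite A" using B finite_subset by auto
    then have "card A = card E + card (A - E)" using A fin by (simp add: card_Diff_subset card_mono)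
    then show "(- 1) ^ card E * (- 1 :: real) ^ card (A - E) = (- 1) ^ card A" by (simp add: power_add)
  qed (use E in auto)
  also have "\<dots> = (- 1) ^ card E * (\<Sum>X\<in>Pow (B - E). (\<Prod>x\<in>X. - 1) * (\<Prod>x\<in>(B - E) - X. 1))"
    by (simp add: sum_distrib_left)
  also have "\<dots> = (- 1) ^ card E * (\<Prod>x\<in>B - E. (- 1) + 1)"
    using fin by (subst prod_add) auto
  also have "\<dots> = (if E = B then (- 1) ^ card E else 0)"
    using fin E by (auto simp: prod_zero_iff)
  finally show ?thesis .
qed

text \<open>
A set \<open>A\<close> of sifting primes stands for the squarefree integer \<open>\<Prod>A\<close>, and \<open>Q\<close> is the level of the
weights. In the usual notation, \<open>phi A\<close> is Euler's totient of \<open>\<Prod>A\<close>, \<open>G\<close> is the sum of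
\<open>\<mu>(q)^2 / \<phi>(q)\<close> over \<open>q \<le> Q\<close>, and \<open>rho\<close> are the optimal weights of Selberg.
\<close>
locale selberg =
  fixes P :: "nat set" and Q :: nat
  assumes fin: "finite P" and prime: "\<And>p. p \<in> P \<Longrightarrow> prime p" and Q: "1 \<le> Q"
begin

definition index :: "nat set set" where
  "index = {A. A \<subseteq> P \<and> \<Prod>A \<le> Q}"

definition phi :: "nat set \<Rightarrow> real" where
  "phi A = (\<Prod>p\<in>A. real p - 1)"

definition G :: real where
  "G = (\<Sum>A\<in>index. 1 / phi A)"

definition rho :: "nat set \<Rightarrow> real" where
  "rho A = (- 1) ^ card A * (real (\<Prod>A) / G) * (\<Sum>B | B \<in> index \<and> A \<subseteq> B. 1 / phi B)"

definition sieve_weight :: "nat \<Rightarrow> real" where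
  "sieve_weight n = (\<Sum>A\<in>index. rho A * of_bool (\<Prod>A dvd n))"

lemma finite_index [simp]: "finite index"
  unfolding index_def by (rule finite_subset[of _ "Pow P"]) (use fin in auto)

lemma indexD: "A \<in> index \<Longrightarrow> A \<subseteq> P" "A \<in> index \<Longrightarrow> finite A" "A \<in> index \<Longrightarrow> \<Prod>A \<le> Q"
  unfolding index_def using finite_subset[OF _ fin] by simp_all

lemma index_prime: "A \<in> index \<Longrightarrow> p \<in> A \<Longrightarrow> prime p"
  using indexD(1) prime by blast

lemma prod_index_pos: "A \<in> index \<Longrightarrow> 0 < \<Prod>A"
  by (intro prod_pos ballI prime_gt_0_nat index_prime)

lemma index_subset:
  assumes "A \<in> index" "E \<subseteq> A"
  shows "E \<in> index"
proof -
  have "\<Prod>E dvd \<Prod>A"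
    by (rule prod_dvd_prod_subset[OF indexD(2)[OF assms(1)] assms(2)])
  then have "\<Prod>E \<le> \<Prod>A" using prod_index_pos[OF assms(1)] by (rule dvd_imp_le)
  then show ?thesis using assms by (auto simp: index_def)
qed

lemma empty_index [simp]: "{} \<in> index"
  using Q by (simp add: index_def)

lemma phi_pos: "A \<in> index \<Longrightarrow> 0 < phi A"
  unfolding phi_def
proof (rule prod_pos)
  fix p assume "A \<in> index" "p \<in> A"
  then show "0 < real p - 1" using prime_gt_1_nat[OF index_prime, of A p] by simp
qed

lemma phi_Un:
  "finite A \<Longrightarrow> finite B \<Longrightarrow> A \<inter> B = {} \<Longrightarrow> phi (A \<union> B) = phi A * phi B"
  unfolding phi_def by (rule prod.union_disjoint)

lemma G_ge_1: "1 \<le> G"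
proof -
  have "1 / phi {} \<le> G"
    unfolding G_def
    by (rule member_le_sum[where f = "\<lambda>A. 1 / phi A"]) (auto intro!: less_imp_le[OF phi_pos])
  then show ?thesis by (simp add: phi_def)
qed

lemma sum_phi_subsets:
  assumes "finite A"
  shows "(\<Sum>E\<in>Pow A. phi E) = real (\<Prod>A)"
proof -
  have "real (\<Prod>A) = (\<Prod>p\<in>A. (real p - 1) + 1)" by (simp add: of_nat_prod)
  also have "\<dots> = (\<Sum>E\<in>Pow A. phi E)" unfolding prod_add[OF assms] phi_def by simp
  finally show ?thesis ..
qed

lemma sum_inverse_phi_subsets:
  assumes "A \<in> index"
  shows "(\<Sum>E\<in>Pow A. 1 / phi E) = real (\<Prod>A) / phi A"
proof -
  have "real (\<Prod>A) / phi A = (\<Prod>p\<in>A. real p / (real p - 1))"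
    by (simp add: phi_def of_nat_prod prod_dividef)
  also have "\<dots> = (\<Prod>p\<in>A. 1 / (real p - 1) + 1)"
  proof (rule prod.cong[OF refl])
    fix p assume "p \<in> A"
    then have "1 < p" using prime_gt_1_nat[OF index_prime[OF assms]] by blast
    then show "real p / (real p - 1) = 1 / (real p - 1) + 1" by (simp add: field_simps)
  qed
  also have "\<dots> = (\<Sum>E\<in>Pow A. 1 / phi E)"
    unfolding prod_add[OF indexD(2)[OF assms]] phi_def by (simp add: prod_dividef)
  finally show ?thesis ..
qed

text \<open>
Each set in the range of \<open>G\<close> can be split into its part \<open>E\<close> inside \<open>A\<close> and its part \<open>B\<close> outside.
Keeping only those \<open>B\<close> for which even \<open>A \<union> B\<close> respects the level, \<open>E\<close> and \<open>B\<close> vary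
independently, and the resulting product is \<open>G * \<bar>rho A\<bar>\<close>.
\<close>
lemma abs_rho_le_1:
  assumes A: "A \<in> index"
  shows "\<bar>rho A\<bar> \<le> 1"
proof -
  define R where "R = {B. B \<inter> A = {} \<and> A \<union> B \<in> index}"
  have R: "finite R" "\<And>B. B \<in> R \<Longrightarrow> B \<in> index"
  proof -
    show R_index: "B \<in> index" if "B \<in> R" for B
      using that index_subset[of "A \<union> B" B] unfolding R_def by blast
    show "finite R" by (rule finite_subset[OF _ finite_index]) (use R_index in blast)
  qed
  have "(\<Sum>B | B \<in> index \<and> A \<subseteq> B. 1 / phi B) = (\<Sum>B\<in>R. 1 / phi (A \<union> B))"
  proof (rule sum.reindex_bij_witness[where i = "\<lambda>B. A \<union> B" and j = "\<lambda>B. B - A"])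
    fix B assume "B \<in> {B \<in> index. A \<subseteq> B}"
    then have B: "B \<in> index" "A \<union> (B - A) = B" by blast+
    then show "A \<union> (B - A) = B" "1 / phi (A \<union> (B - A)) = 1 / phi B" by simp_all
    show "B - A \<in> R" unfolding R_def using B by (simp only: mem_Collect_eq) blast
  next
    fix B assume "B \<in> R"
    then show "A \<union> B - A = B" "A \<union> B \<in> {B \<in> index. A \<subseteq> B}" unfolding R_def by blast+
  qed
  also have "\<dots> = (\<Sum>B\<in>R. 1 / phi B) / phi A"
    unfolding sum_divide_distrib
  proof (rule sum.cong[OF refl])
    fix B assume "B \<in> R"
    then have "phi (A \<union> B) = phi A * phi B"
      by (intro phi_Un indexD(2) A R(2)) (auto simp: R_def)
    then show "1 / phi (A \<union> B) = 1 / phi B / phi A" by simp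
  qed
  finally have "real (\<Prod>A) * (\<Sum>B | B \<in> index \<and> A \<subseteq> B. 1 / phi B)
     = (\<Sum>E\<in>Pow A. 1 / phi E) * (\<Sum>B\<in>R. 1 / phi B)"
    unfolding sum_inverse_phi_subsets[OF A] by simp
  also have "\<dots> = (\<Sum>(E, B)\<in>Pow A \<times> R. 1 / phi (E \<union> B))"
    unfolding sum_product sum.cartesian_product
  proof (intro sum.cong refl, clarify)
    fix E B assume "E \<subseteq> A" "B \<in> R"
    then have "finite E" "finite B" using indexD(2)[OF A] indexD(2)[OF R(2)] finite_subset by blast+
    moreover have "E \<inter> B = {}" using \<open>E \<subseteq> A\<close> \<open>B \<in> R\<close> unfolding R_def by blast
    ultimately show "1 / phi E * (1 / phi B) = 1 / phi (E \<union> B)" by (simp add: phi_Un)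
  qed
  also have "\<dots> = (\<Sum>C\<in>(\<lambda>(E, B). E \<union> B) ` (Pow A \<times> R). 1 / phi C)"
  proof -
    have "inj_on (\<lambda>(E, B). E \<union> B) (Pow A \<times> R)"
    proof (rule inj_on_inverseI[where g = "\<lambda>C. (C \<inter> A, C - A)"])
      fix x assume "x \<in> Pow A \<times> R"
      then obtain E B where x: "x = (E, B)" "E \<subseteq> A" "B \<inter> A = {}" unfolding R_def by blast
      then have "(E \<union> B) \<inter> A = E" "(E \<union> B) - A = B" by blast+
      then show "(\<lambda>C. (C \<inter> A, C - A)) ((\<lambda>(E, B). E \<union> B) x) = x" by (simp add: x(1))
    qed
    then show ?thesis by (simp add: sum.reindex case_prod_unfold)
  qed
  also have "\<dots> \<le> G"
    unfolding G_def
  proof (rule sum_mono2)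
    show "(\<lambda>(E, B). E \<union> B) ` (Pow A \<times> R) \<subseteq> index"
    proof clarify
      fix E B assume "E \<subseteq> A" "B \<in> R"
      then have "A \<union> B \<in> index" "E \<union> B \<subseteq> A \<union> B" unfolding R_def by blast+
      then show "E \<union> B \<in> index" by (rule index_subset)
    qed
  qed (auto intro!: less_imp_le[OF phi_pos])
  finally have main: "real (\<Prod>A) * (\<Sum>B | B \<in> index \<and> A \<subseteq> B. 1 / phi B) \<le> G" .
  have "0 \<le> (\<Sum>B | B \<in> index \<and> A \<subseteq> B. 1 / phi B)"
    by (intro sum_nonneg) (auto intro!: less_imp_le[OF phi_pos])
  then have "\<bar>rho A\<bar> = real (\<Prod>A) * (\<Sum>B | B \<in> index \<and> A \<subseteq> B. 1 / phi B) / G"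
    using G_ge_1 by (simp add: rho_def abs_mult power_abs abs_prod)
  then show ?thesis using main G_ge_1 by simp
qed

lemma rho_empty: "rho {} = 1"
  using G_ge_1 by (simp add: rho_def flip: G_def)

lemma sum_rho_over:
  assumes E: "E \<in> index"
  shows "(\<Sum>A | A \<in> index \<and> E \<subseteq> A. rho A / real (\<Prod>A)) = (- 1) ^ card E / (G * phi E)"
proof -
  have "(\<Sum>A | A \<in> index \<and> E \<subseteq> A. rho A / real (\<Prod>A))
     = (\<Sum>A | A \<in> index \<and> E \<subseteq> A. \<Sum>B | B \<in> index \<and> A \<subseteq> B. (- 1) ^ card A / (G * phi B))"
  proof (intro sum.cong refl, clarify)
    fix A assume "A \<in> index"
    then show "rho A / real (\<Prod>A) = (\<Sum>B | B \<in> index \<and> A \<subseteq> B. (- 1) ^ card A / (G * phi B))"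
      using prod_index_pos[of A] unfolding rho_def
      by (simp add: sum_distrib_left sum_divide_distrib del: of_nat_prod)
  qed
  also have "\<dots> = (\<Sum>B\<in>index. \<Sum>A | A \<in> {A \<in> index. E \<subseteq> A} \<and> A \<subseteq> B. (- 1) ^ card A / (G * phi B))"
    by (rule sum.swap_restrict) auto
  also have "\<dots> = (\<Sum>B\<in>index. if B = E then (- 1) ^ card E / (G * phi B) else 0)"
  proof (intro sum.cong refl)
    fix B assume B: "B \<in> index"
    have "{A. A \<in> {A \<in> index. E \<subseteq> A} \<and> A \<subseteq> B} = {A. E \<subseteq> A \<and> A \<subseteq> B}"
      using index_subset[OF B] by auto
    then have "(\<Sum>A | A \<in> {A \<in> index. E \<subseteq> A} \<and> A \<subseteq> B. (- 1) ^ card A / (G * phi B))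
        = (\<Sum>A | E \<subseteq> A \<and> A \<subseteq> B. (- 1) ^ card A) / (G * phi B)"
      by (simp only: sum_divide_distrib)
    also have "\<dots> = (if B = E then (- 1) ^ card E / (G * phi B) else 0)"
    proof (cases "E \<subseteq> B")
      case True
      then show ?thesis using sum_signs_between[OF indexD(2)[OF B] True] by auto
    next
      case False
      then have none: "{A. E \<subseteq> A \<and> A \<subseteq> B} = {}" by auto
      show ?thesis unfolding none using False by auto
    qed
    finally show "(\<Sum>A | A \<in> {A \<in> index. E \<subseteq> A} \<and> A \<subseteq> B. (- 1) ^ card A / (G * phi B))
        = (if B = E then (- 1) ^ card E / (G * phi B) else 0)" .
  qed
  also have "\<dots> = (- 1) ^ card E / (G * phi E)" using E by simp
  finally show ?thesis .
qed

text \<open>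
The quadratic form is diagonalised by \<open>\<Prod>(A \<union> B) * \<Prod>(A \<inter> B) = \<Prod>A * \<Prod>B\<close> and by writing
\<open>\<Prod>(A \<inter> B)\<close> as the sum of \<open>phi E\<close> over the common subsets \<open>E\<close>; in the new
coordinates, computed in \<open>sum_rho_over\<close>, it is \<open>1 / G\<^sup>2\<close> times the sum defining \<open>G\<close>.
\<close>
lemma selberg_diagonal:
  "(\<Sum>A\<in>index. \<Sum>B\<in>index. rho A * rho B / real (\<Prod>(A \<union> B))) = 1 / G"
proof -
  have "(\<Sum>A\<in>index. \<Sum>B\<in>index. rho A * rho B / real (\<Prod>(A \<union> B)))
     = (\<Sum>A\<in>index. \<Sum>B\<in>index. \<Sum>E\<in>index. of_bool (E \<subseteq> A) * of_bool (E \<subseteq> B) * phi E * (rho A / real (\<Prod>A)) * (rho B / real (\<Prod>B)))"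
  proof (intro sum.cong refl)
    fix A B assume A: "A \<in> index" and B: "B \<in> index"
    have pos: "0 < real (\<Prod>A)" "0 < real (\<Prod>B)" 
      using prod_index_pos[OF A] prod_index_pos[OF B] by (simp_all only: of_nat_0_less_iff)
    have "(\<Sum>E\<in>index. of_bool (E \<subseteq> A) * of_bool (E \<subseteq> B) * phi E * (rho A / real (\<Prod>A)) * (rho B / real (\<Prod>B)))
      = (\<Sum>E\<in>index. if E \<in> Pow (A \<inter> B) then phi E * ((rho A / real (\<Prod>A)) * (rho B / real (\<Prod>B))) else 0)"
      by (intro sum.cong) auto
    also have "\<dots> = (\<Sum>E\<in>Pow (A \<inter> B). phi E * ((rho A / real (\<Prod>A)) * (rho B / real (\<Prod>B))))"
      using index_subset[OF A] by (subst sum.inter_restrict[symmetric]) (auto intro!: sum.cong)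
    also have "\<dots> = real (\<Prod>(A \<inter> B)) * ((rho A / real (\<Prod>A)) * (rho B / real (\<Prod>B)))"
      by (simp only: sum_distrib_right[symmetric] sum_phi_subsets[OF finite_Int[OF disjI1[OF indexD(2)[OF A]]]])
    also have "\<dots> = rho A * rho B / real (\<Prod>(A \<union> B))"
    proof -
      have "\<Prod>(A \<union> B) * \<Prod>(A \<inter> B) = \<Prod>A * \<Prod>B"
        using prod.union_inter[of A B "\<lambda>x. x"] indexD(2) A B by simp
      then have "real (\<Prod>(A \<union> B)) * real (\<Prod>(A \<inter> B)) = real (\<Prod>A) * real (\<Prod>B)"
        by (metis of_nat_mult)
      moreover from this pos have "real (\<Prod>(A \<union> B)) \<noteq> 0" by (metis mult_eq_0_iff less_irrefl)
      ultimately have "real (\<Prod>(A \<inter> B)) = real (\<Prod>A) * real (\<Prod>B) / real (\<Prod>(A \<union> B))"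
        by (metis nonzero_mult_div_cancel_left)
      then show ?thesis using pos by (simp del: of_nat_prod)
    qed
    finally show "rho A * rho B / real (\<Prod>(A \<union> B)) = (\<Sum>E\<in>index. of_bool (E \<subseteq> A) * of_bool (E \<subseteq> B) * phi E * (rho A / real (\<Prod>A)) * (rho B / real (\<Prod>B)))" ..
  qed
  also have "\<dots> = (\<Sum>A\<in>index. \<Sum>E\<in>index. \<Sum>B\<in>index. of_bool (E \<subseteq> A) * of_bool (E \<subseteq> B) * phi E * (rho A / real (\<Prod>A)) * (rho B / real (\<Prod>B)))"
    by (rule sum.cong[OF refl], rule sum.swap)
  also have "\<dots> = (\<Sum>E\<in>index. \<Sum>A\<in>index. \<Sum>B\<in>index. of_bool (E \<subseteq> A) * of_bool (E \<subseteq> B) * phi E * (rho A / real (\<Prod>A)) * (rho B / real (\<Prod>B)))"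
    by (rule sum.swap)
  also have "\<dots> = (\<Sum>E\<in>index. phi E * (\<Sum>A\<in>index. of_bool (E \<subseteq> A) * (rho A / real (\<Prod>A))) ^ 2)"
  proof (rule sum.cong[OF refl])
    fix E
    define u where "u A = of_bool (E \<subseteq> A) * (rho A / real (\<Prod>A))" for A
    have "(\<Sum>A\<in>index. \<Sum>B\<in>index. of_bool (E \<subseteq> A) * of_bool (E \<subseteq> B) * phi E * (rho A / real (\<Prod>A)) * (rho B / real (\<Prod>B)))
      = (\<Sum>A\<in>index. \<Sum>B\<in>index. phi E * (u A * u B))"
      unfolding u_def by (rule sum.cong[OF refl], rule sum.cong[OF refl]) (simp only: mult_ac)
    also have "\<dots> = phi E * (\<Sum>A\<in>index. u A) ^ 2"
      unfolding power2_eq_square sum_product by (simp only: sum_distrib_left)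
    finally show "(\<Sum>A\<in>index. \<Sum>B\<in>index. of_bool (E \<subseteq> A) * of_bool (E \<subseteq> B) * phi E * (rho A / real (\<Prod>A)) * (rho B / real (\<Prod>B)))
      = phi E * (\<Sum>A\<in>index. of_bool (E \<subseteq> A) * (rho A / real (\<Prod>A))) ^ 2"
      by (simp only: u_def)
  qed
  also have "\<dots> = (\<Sum>E\<in>index. phi E * ((- 1) ^ card E / (G * phi E)) ^ 2)"
  proof (intro sum.cong refl)
    fix E assume "E \<in> index"
    have "(\<Sum>A\<in>index. of_bool (E \<subseteq> A) * (rho A / real (\<Prod>A))) = (\<Sum>A | A \<in> index \<and> E \<subseteq> A. rho A / real (\<Prod>A))"
      by (rule sum.mono_neutral_cong_right) auto
    then show "phi E * (\<Sum>A\<in>index. of_bool (E \<subseteq> A) * (rho A / real (\<Prod>A))) ^ 2 = phi E * ((- 1) ^ card E / (G * phi E)) ^ 2"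
      by (simp only: sum_rho_over[OF \<open>E \<in> index\<close>])
  qed
  also have "\<dots> = (\<Sum>E\<in>index. 1 / phi E * (1 / G ^ 2))"
  proof (rule sum.cong[OF refl])
    fix E assume "E \<in> index"
    then have "phi E \<noteq> 0" using phi_pos[of E] by simp
    moreover have "((- 1 :: real) ^ card E) ^ 2 = 1" by (simp flip: power_mult)
    ultimately show "phi E * ((- 1) ^ card E / (G * phi E)) ^ 2 = 1 / phi E * (1 / G ^ 2)"
      by (simp add: power_divide power_mult_distrib power2_eq_square)
  qed
  also have "\<dots> = G * (1 / G ^ 2)" by (simp only: sum_distrib_right[symmetric] G_def[symmetric])
  also have "\<dots> = 1 / G" by (simp add: power2_eq_square)
  finally show ?thesis .
qed

lemma index_Un:
  assumes "A \<in> index" "B \<in> index"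
  shows "finite (A \<union> B)" "\<And>p. p \<in> A \<union> B \<Longrightarrow> prime p"
  using indexD(2)[OF assms(1)] indexD(2)[OF assms(2)] index_prime[OF assms(1)] index_prime[OF assms(2)] by auto

lemma sieve_weight_square:
  "sieve_weight n ^ 2 = (\<Sum>(A, B)\<in>index \<times> index. rho A * rho B * of_bool (\<Prod>(A \<union> B) dvd n))"
proof -
  have "sieve_weight n ^ 2 = (\<Sum>A\<in>index. \<Sum>B\<in>index. rho A * of_bool (\<Prod>A dvd n) * (rho B * of_bool (\<Prod>B dvd n)))"
    by (simp only: sieve_weight_def power2_eq_square sum_product)
  also have "\<dots> = (\<Sum>A\<in>index. \<Sum>B\<in>index. rho A * rho B * of_bool (\<Prod>(A \<union> B) dvd n))"
  proof (rule sum.cong[OF refl], rule sum.cong[OF refl])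
    fix A B assume A: "A \<in> index" and B: "B \<in> index"
    have "\<Prod>(A \<union> B) dvd n \<longleftrightarrow> \<Prod>A dvd n \<and> \<Prod>B dvd n"
      using prod_primes_dvd_iff[OF index_Un[OF A B], of n] prod_primes_dvd_iff[OF indexD(2)[OF A] index_prime[OF A], of n]
        prod_primes_dvd_iff[OF indexD(2)[OF B] index_prime[OF B], of n] by blast
    then show "rho A * of_bool (\<Prod>A dvd n) * (rho B * of_bool (\<Prod>B dvd n)) = rho A * rho B * of_bool (\<Prod>(A \<union> B) dvd n)"
      by simp
  qed
  finally show ?thesis by (simp only: sum.cartesian_product)
qed

lemma sieve_weight_sifted:
  assumes "\<And>p. p \<in> P \<Longrightarrow> \<not> p dvd n"
  shows "sieve_weight n = 1"
proof -
  have "sieve_weight n = (\<Sum>A\<in>index. if A = {} then rho {} else 0)"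
    unfolding sieve_weight_def
  proof (rule sum.cong[OF refl])
    fix A assume A: "A \<in> index"
    have "\<Prod>A dvd n \<longleftrightarrow> (\<forall>p\<in>A. p dvd n)" by (rule prod_primes_dvd_iff[OF indexD(2)[OF A] index_prime[OF A]])
    moreover have "(\<forall>p\<in>A. p dvd n) \<longleftrightarrow> A = {}" using assms indexD(1)[OF A] by blast
    ultimately show "rho A * of_bool (\<Prod>A dvd n) = (if A = {} then rho {} else 0)" by auto
  qed
  then show ?thesis by (simp add: rho_empty)
qed

text \<open>
The product of the squared weights in \<open>n\<close> and in \<open>g n\<close> is nonnegative and equals 1 on the sifted
integers. Expanding the squares, the main terms form the product of two copies of the Selberg form, one
for each coordinate. In the errors the weights are bounded by 1, and the sums over the two
coordinates separate.
\<close>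
proposition joint_sieve:
  fixes N :: nat and g :: "nat \<Rightarrow> nat" and S :: "nat \<Rightarrow> real"
  assumes discrepancy: "\<And>A B A' B'. A \<in> index \<Longrightarrow> B \<in> index \<Longrightarrow> A' \<in> index \<Longrightarrow> B' \<in> index \<Longrightarrow>
     \<bar>real (card {n. n < N \<and> \<Prod>(A \<union> B) dvd n \<and> \<Prod>(A' \<union> B') dvd g n})
        - real N / (real (\<Prod>(A \<union> B)) * real (\<Prod>(A' \<union> B')))\<bar>
     \<le> real N / (real (\<Prod>(A \<union> B)) * real (\<Prod>(A' \<union> B'))) * (S (\<Prod>(A \<union> B)) * S (\<Prod>(A' \<union> B')) - 1)"
  shows "real (card {n. n < N \<and> (\<forall>p\<in>P. \<not> p dvd n) \<and> (\<forall>p\<in>P. \<not> p dvd g n)})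
     \<le> real N * ((1 / G) ^ 2 + (\<Sum>(A, B)\<in>index \<times> index. S (\<Prod>(A \<union> B)) / real (\<Prod>(A \<union> B))) ^ 2
        - (\<Sum>(A, B)\<in>index \<times> index. 1 / real (\<Prod>(A \<union> B))) ^ 2)"
proof -
  define I where "I = index \<times> index"
  define w where "w = (\<lambda>(A, B). rho A * rho B)"
  define r where "r = (\<lambda>(A, B). \<Prod>(A \<union> B :: nat set))"
  define K where "K i j = real (card {n. n < N \<and> r i dvd n \<and> r j dvd g n})" for i j
  have w1: "\<bar>w i\<bar> \<le> 1" if "i \<in> I" for i
    using that abs_rho_le_1 unfolding I_def w_def by (auto simp: abs_mult mult_le_one)
  have disc: "\<bar>K i j - real N / (real (r i) * real (r j))\<bar>
     \<le> real N / (real (r i) * real (r j)) * (S (r i) * S (r j) - 1)" if "i \<in> I" "j \<in> I" for i j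
    using discrepancy that unfolding I_def K_def r_def by fastforce
  have sq: "sieve_weight n ^ 2 = (\<Sum>i\<in>I. w i * of_bool (r i dvd n))" for n
    unfolding sieve_weight_square I_def w_def r_def by (simp only: case_prod_unfold)
  have "real (card {n. n < N \<and> (\<forall>p\<in>P. \<not> p dvd n) \<and> (\<forall>p\<in>P. \<not> p dvd g n)})
     = (\<Sum>n | n < N \<and> (\<forall>p\<in>P. \<not> p dvd n) \<and> (\<forall>p\<in>P. \<not> p dvd g n). sieve_weight n ^ 2 * sieve_weight (g n) ^ 2)"
    by (simp add: sieve_weight_sifted)
  also have "\<dots> \<le> (\<Sum>n<N. sieve_weight n ^ 2 * sieve_weight (g n) ^ 2)"
    by (rule sum_mono2) auto
  also have "\<dots> = (\<Sum>n<N. \<Sum>i\<in>I. \<Sum>j\<in>I. w i * w j * of_bool (r i dvd n \<and> r j dvd g n))"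
    unfolding sq sum_product
    by (rule sum.cong[OF refl], rule sum.cong[OF refl], rule sum.cong[OF refl]) simp
  also have "\<dots> = (\<Sum>i\<in>I. \<Sum>n<N. \<Sum>j\<in>I. w i * w j * of_bool (r i dvd n \<and> r j dvd g n))"
    by (rule sum.swap)
  also have "\<dots> = (\<Sum>i\<in>I. \<Sum>j\<in>I. \<Sum>n<N. w i * w j * of_bool (r i dvd n \<and> r j dvd g n))"
    by (rule sum.cong[OF refl], rule sum.swap)
  also have "\<dots> = (\<Sum>i\<in>I. \<Sum>j\<in>I. w i * w j * K i j)"
  proof (rule sum.cong[OF refl], rule sum.cong[OF refl])
    fix i j
    have "{n. n < N \<and> r i dvd n \<and> r j dvd g n} = {..<N} \<inter> {n. r i dvd n \<and> r j dvd g n}" by auto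
    then have "K i j = (\<Sum>n<N. of_bool (r i dvd n \<and> r j dvd g n))"
      by (simp only: K_def sum_of_bool_eq finite_lessThan)
    then show "(\<Sum>n<N. w i * w j * of_bool (r i dvd n \<and> r j dvd g n)) = w i * w j * K i j"
      by (simp only: sum_distrib_left)
  qed
  also have "\<dots> \<le> (\<Sum>i\<in>I. \<Sum>j\<in>I. real N * ((w i / real (r i)) * (w j / real (r j))
      + (S (r i) / real (r i)) * (S (r j) / real (r j)) - (1 / real (r i)) * (1 / real (r j))))"
  proof (rule sum_mono, rule sum_mono)
    fix i j assume i: "i \<in> I" and j: "j \<in> I"
    define M where "M = real N / (real (r i) * real (r j))"
    have "\<bar>w i * w j\<bar> \<le> 1" using w1[OF i] w1[OF j] by (simp add: abs_mult mult_le_one)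
    then have "\<bar>w i * w j * (K i j - M)\<bar> \<le> 1 * \<bar>K i j - M\<bar>"
      unfolding abs_mult[of "w i * w j"] by (intro mult_right_mono) auto
    also have "\<dots> \<le> M * (S (r i) * S (r j) - 1)" using disc[OF i j] by (simp add: M_def)
    finally have "w i * w j * (K i j - M) \<le> M * (S (r i) * S (r j) - 1)" by linarith
    then have "w i * w j * K i j \<le> M * (w i * w j + S (r i) * S (r j) - 1)"
      by (simp add: algebra_simps)
    also have "\<dots> = real N * ((w i / real (r i)) * (w j / real (r j))
      + (S (r i) / real (r i)) * (S (r j) / real (r j)) - (1 / real (r i)) * (1 / real (r j)))"
      unfolding M_def by (simp add: add_divide_distrib diff_divide_distrib distrib_left right_diff_distrib)
    finally show "w i * w j * K i j \<le> \<dots>" .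
  qed
  also have "\<dots> = real N * ((\<Sum>i\<in>I. w i / real (r i)) ^ 2 + (\<Sum>i\<in>I. S (r i) / real (r i)) ^ 2 - (\<Sum>i\<in>I. 1 / real (r i)) ^ 2)"
    unfolding power2_eq_square sum_product
    by (simp only: sum_distrib_left[symmetric] sum.distrib sum_subtractf)
  also have "(\<Sum>i\<in>I. w i / real (r i)) = 1 / G"
    unfolding selberg_diagonal[symmetric] I_def w_def r_def by (simp only: sum.cartesian_product case_prod_unfold)
  finally show ?thesis unfolding I_def r_def by (simp only: case_prod_unfold)
qed

text \<open>
Split \<open>A \<union> B\<close> into \<open>D\<close> and, outside \<open>D\<close>, the three disjoint sets \<open>A \<inter> B\<close>, \<open>A - B\<close> and \<open>B - A\<close>, each
respecting the level. The traces of \<open>A\<close> and \<open>B\<close> on \<open>D\<close> account for at most \<open>4 ^ card D\<close> choices.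
\<close>
lemma sum_inverse_lcm_le:
  assumes D: "finite D" "D \<subseteq> P"
  shows "(\<Sum>(A, B) | (A, B) \<in> index \<times> index \<and> D \<subseteq> A \<union> B. 1 / real (\<Prod>(A \<union> B)))
     \<le> 4 ^ card D / real (\<Prod>D) * (\<Sum>X\<in>index. 1 / real (\<Prod>X)) ^ 3"
proof -
  define T where "T = (Pow D \<times> Pow D) \<times> (index \<times> index \<times> index)"
  define f :: "nat set \<times> nat set \<Rightarrow> real" where "f = (\<lambda>(A, B). 1 / real (\<Prod>(A \<union> B)))"
  define g where "g = (\<lambda>(_ :: nat set \<times> nat set, X, Y, Z). 1 / real (\<Prod>D) * (1 / real (\<Prod>X) * (1 / real (\<Prod>Y) * (1 / real (\<Prod>Z :: nat)))))"
  have "sum f {(A, B). (A, B) \<in> index \<times> index \<and> D \<subseteq> A \<union> B} \<le> sum g T"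
  proof (rule sum_le_included[where i = "\<lambda>((a, b), X, Y, Z). (a \<union> X \<union> Y, b \<union> X \<union> Z)"])
    show "finite {(A, B). (A, B) \<in> index \<times> index \<and> D \<subseteq> A \<union> B}"
      by (rule finite_subset[of _ "index \<times> index"]) auto
    show "finite T" unfolding T_def using D by simp
    show "\<forall>y\<in>T. 0 \<le> g y" unfolding T_def g_def by (auto simp del: of_nat_prod)
    show "\<forall>x\<in>{(A, B). (A, B) \<in> index \<times> index \<and> D \<subseteq> A \<union> B}. \<exists>y\<in>T. (case y of (ab, XYZ) \<Rightarrow>
        (case ab of (a, b) \<Rightarrow> \<lambda>(X, Y, Z). (a \<union> X \<union> Y, b \<union> X \<union> Z)) XYZ) = x \<and> f x \<le> g y"
    proof
      fix x assume "x \<in> {(A, B). (A, B) \<in> index \<times> index \<and> D \<subseteq> A \<union> B}"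
      then obtain A B where x: "x = (A, B)" and AB: "A \<in> index" "B \<in> index" and DAB: "D \<subseteq> A \<union> B" by blast
      define X where "X = A \<inter> B - D"
      define Y where "Y = A - B - D"
      define Z where "Z = B - A - D"
      have sub: "X \<subseteq> A" "Y \<subseteq> A" "Z \<subseteq> B" unfolding X_def Y_def Z_def by auto
      have idx: "X \<in> index" "Y \<in> index" "Z \<in> index"
        using index_subset[OF AB(1) sub(1)] index_subset[OF AB(1) sub(2)] index_subset[OF AB(2) sub(3)] by auto
      have split: "A \<union> B = D \<union> (X \<union> (Y \<union> Z))" using DAB unfolding X_def Y_def Z_def by auto
      have disj: "D \<inter> (X \<union> (Y \<union> Z)) = {}" "X \<inter> (Y \<union> Z) = {}" "Y \<inter> Z = {}" unfolding X_def Y_def Z_def by auto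
      have fins: "finite X" "finite Y" "finite Z" using idx indexD(2) by auto
      have "\<Prod>(A \<union> B) = \<Prod>D * (\<Prod>X * (\<Prod>Y * \<Prod>Z))"
        unfolding split using disj fins D by (simp add: prod.union_disjoint)
      then have "f x \<le> g ((A \<inter> D, B \<inter> D), X, Y, Z)"
        unfolding f_def g_def x by (simp del: of_nat_prod)
      moreover have "((A \<inter> D, B \<inter> D), X, Y, Z) \<in> T" unfolding T_def using idx by simp
      moreover have "(A \<inter> D \<union> X \<union> Y, B \<inter> D \<union> X \<union> Z) = x" unfolding x X_def Y_def Z_def by auto
      ultimately show "\<exists>y\<in>T. (case y of (ab, XYZ) \<Rightarrow>
        (case ab of (a, b) \<Rightarrow> \<lambda>(X, Y, Z). (a \<union> X \<union> Y, b \<union> X \<union> Z)) XYZ) = x \<and> f x \<le> g y"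
        by (intro bexI[of _ "((A \<inter> D, B \<inter> D), X, Y, Z)"]) auto
    qed
  qed
  also have "sum g T = (\<Sum>_\<in>Pow D \<times> Pow D. 1 / real (\<Prod>D) * ((\<Sum>X\<in>index. 1 / real (\<Prod>X)) *
      ((\<Sum>X\<in>index. 1 / real (\<Prod>X)) * (\<Sum>X\<in>index. 1 / real (\<Prod>X)))))"
    unfolding T_def g_def sum.cartesian_product[symmetric] by (simp only: sum_distrib_left[symmetric] sum_distrib_right[symmetric])
  also have "\<dots> = 4 ^ card D / real (\<Prod>D) * (\<Sum>X\<in>index. 1 / real (\<Prod>X)) ^ 3"
  proof -
    have "card (Pow D \<times> Pow D) = 4 ^ card D"
      using D by (simp add: card_cartesian_product card_Pow flip: power_mult_distrib)
    then show ?thesis by (simp add: power3_eq_cube del: of_nat_prod)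
  qed
  finally show ?thesis unfolding f_def by (simp only: case_prod_unfold)
qed

lemma sum_index_le_harmonic: "(\<Sum>X\<in>index. 1 / real (\<Prod>X)) \<le> (\<Sum>n=1..Q. 1 / real n)"
proof (rule sum_le_included[where i = prime_factors])
  show "\<forall>X\<in>index. \<exists>n\<in>{1..Q}. prime_factors n = X \<and> 1 / real (\<Prod>X) \<le> 1 / real n"
  proof
    fix X assume X: "X \<in> index"
    show "\<exists>n\<in>{1..Q}. prime_factors n = X \<and> 1 / real (\<Prod>X) \<le> 1 / real n"
      using prime_factors_prod_primes[OF indexD(2)[OF X] index_prime[OF X]] prod_index_pos[OF X] indexD(3)[OF X]
      by (intro bexI[of _ "\<Prod>X"]) (auto simp: Suc_le_eq)
  qed
qed auto

lemma sum_index_le_G: "(\<Sum>X\<in>index. 1 / real (\<Prod>X)) \<le> G"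
  unfolding G_def
proof (rule sum_mono)
  fix A assume A: "A \<in> index"
  have "phi A \<le> (\<Prod>p\<in>A. real p)"
    unfolding phi_def
  proof (rule prod_mono, rule conjI)
    fix p assume "p \<in> A"
    then show "0 \<le> real p - 1" using prime_gt_1_nat[OF index_prime[OF A]] by (simp add: less_imp_le)
  qed simp
  then have "phi A \<le> real (\<Prod>A)" by (simp add: of_nat_prod)
  then show "1 / real (\<Prod>A) \<le> 1 / phi A" using phi_pos[OF A] by (intro divide_left_mono) auto
qed

end

lemma sum_inverse_squares_le: "(\<Sum>k=1..n. 1 / real k ^ 2) \<le> 2"
proof -
  have "(\<Sum>k=1..n. 1 / real k ^ 2) \<le> 2 - 1 / real n"
  proof (induction n)
    case (Suc n)
    show ?case
    proof (cases "n = 0")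
      case False
      have "1 / real (Suc n) ^ 2 \<le> 1 / (real n * real (Suc n))"
        using False by (intro divide_left_mono) (auto simp: power2_eq_square)
      also have "\<dots> = 1 / real n - 1 / real (Suc n)" using False by (simp add: field_simps)
      finally show ?thesis using Suc.IH by simp
    qed simp
  qed simp
  moreover have "0 \<le> 1 / real n" by simp
  ultimately show ?thesis by linarith
qed

text \<open>
Write \<open>n = q k\<^sup>2\<close> with squarefree \<open>q\<close> and divide the primes of \<open>q\<close> into those dividing \<open>a\<close>, with at most
\<open>2 ^ card (prime_factors a)\<close> possibilities, and the others. The sum over \<open>k\<close> is at most 2.
\<close>
lemma harmonic_le_squarefree_sum:
  fixes P :: "nat set"
  assumes P: "P = {p. prime p \<and> p \<le> Q \<and> \<not> p dvd a}" and a: "0 < a" and Q: "1 \<le> Q"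
  shows "(\<Sum>n=1..Q. 1 / real n) \<le> 2 * 2 ^ card (prime_factors a) * (\<Sum>X\<in>selberg.index P Q. 1 / real (\<Prod>X))"
proof -
  have finP: "finite P" unfolding P by (rule finite_subset[of _ "{..Q}"]) auto
  interpret selberg P Q by standard (use finP Q in \<open>auto simp: P\<close>)
  define T where "T = Pow (prime_factors a) \<times> index \<times> {1..Q}"
  define g where "g = (\<lambda>(_ :: nat set, X :: nat set, k). 1 / real (\<Prod>X) * (1 / real k ^ 2))"
  have "(\<Sum>n=1..Q. 1 / real n) \<le> sum g T"
  proof (rule sum_le_included[where i = "\<lambda>(Y, X, k). \<Prod>Y * \<Prod>X * k ^ 2"])
    show "finite T" unfolding T_def by simp
    show "\<forall>y\<in>T. 0 \<le> g y" unfolding T_def g_def by (auto simp del: of_nat_prod)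
    show "\<forall>n\<in>{1..Q}. \<exists>y\<in>T. (case y of (Y, X, k) \<Rightarrow> \<Prod>Y * \<Prod>X * k ^ 2) = n \<and> 1 / real n \<le> g y"
    proof
      fix n assume n: "n \<in> {1..Q}"
      define q where "q = squarefree_part n"
      define k where "k = square_part n"
      have nqk: "n = q * k ^ 2" unfolding q_def k_def by (rule squarefree_decompose)
      have pos: "0 < q" "0 < k" using n nqk by (auto intro!: Nat.gr0I)
      have q: "\<Prod>(prime_factors q) = q" unfolding q_def by (intro prod_prime_factors_squarefree squarefree_squarefree_part)
      define Y where "Y = prime_factors q \<inter> prime_factors a"
      define X where "X = prime_factors q - prime_factors a"
      have "q dvd n" "k ^ 2 dvd n" unfolding nqk by simp_all
      then have qn: "q \<le> n" "k ^ 2 \<le> n" using n by (auto intro: dvd_imp_le)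
      then have qQ: "q \<le> Q" using n by simp
      have "k \<le> k ^ 2" using pos by (simp add: power2_eq_square)
      then have kQ: "k \<in> {1..Q}" using n qn pos by simp
      have "\<Prod>Y * \<Prod>X = \<Prod>(Y \<union> X)"
        by (rule prod.union_disjoint[symmetric]) (auto simp: X_def Y_def)
      also have "Y \<union> X = prime_factors q" unfolding X_def Y_def by auto
      finally have YX: "\<Prod>Y * \<Prod>X = q" unfolding q .
      have XP: "X \<subseteq> P"
      proof
        fix p assume p: "p \<in> X"
        then have "prime p" "p dvd q" unfolding X_def by auto
        moreover from this have "p \<le> q" using pos by (intro dvd_imp_le) auto
        moreover have "\<not> p dvd a" using p \<open>prime p\<close> a unfolding X_def by (simp add: in_prime_factors_iff)
        ultimately show "p \<in> P" unfolding P using qQ by simp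
      qed
      have Xq: "\<Prod>X \<le> q" by (rule dvd_imp_le[OF dvdI[of _ _ "\<Prod>Y"] pos(1)]) (simp only: YX[symmetric] mult.commute)
      then have "X \<in> index" using XP qQ by (simp add: index_def)
      then have T: "(Y, X, k) \<in> T" using kQ unfolding T_def Y_def by simp
      have "0 < \<Prod>X" using pos(1) unfolding YX[symmetric] by simp
      then have "0 < real (\<Prod>X)" "real (\<Prod>X) \<le> real q" using Xq by (simp_all only: of_nat_0_less_iff of_nat_le_iff)
      then have "1 / real q \<le> 1 / real (\<Prod>X)" by (intro divide_left_mono mult_pos_pos) linarith+
      then have "1 / real q * (1 / real k ^ 2) \<le> 1 / real (\<Prod>X) * (1 / real k ^ 2)"
        by (intro mult_right_mono) auto
      then have "1 / real n \<le> g (Y, X, k)" unfolding nqk g_def by simp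
      moreover have "\<Prod>Y * \<Prod>X * k ^ 2 = n" unfolding YX nqk ..
      ultimately show "\<exists>y\<in>T. (case y of (Y, X, k) \<Rightarrow> \<Prod>Y * \<Prod>X * k ^ 2) = n \<and> 1 / real n \<le> g y"
        using T by (intro bexI[of _ "(Y, X, k)"]) auto
    qed
  qed simp
  also have "sum g T = 2 ^ card (prime_factors a) * ((\<Sum>X\<in>index. 1 / real (\<Prod>X)) * (\<Sum>k=1..Q. 1 / real k ^ 2))"
    unfolding T_def g_def sum.cartesian_product[symmetric] sum_product
    by (simp add: card_Pow del: of_nat_prod)
  also have "\<dots> \<le> 2 ^ card (prime_factors a) * ((\<Sum>X\<in>index. 1 / real (\<Prod>X)) * 2)"
    by (intro mult_left_mono sum_inverse_squares_le sum_nonneg) (auto simp del: of_nat_prod)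
  finally show ?thesis by (simp add: mult_ac)
qed

lemma ln_le_harmonic: "ln (real n) \<le> (\<Sum>k=1..n. 1 / real k)"
proof (cases "n = 0")
  case False
  have "ln (real n) \<le> ln (real n + 1)" using False by (subst ln_le_cancel_iff) auto
  also have "\<dots> \<le> (\<Sum>k=1..n. 1 / real k)" using ln_le_harm[of n] by (simp add: harm_def inverse_eq_divide)
  finally show ?thesis .
qed simp

lemma harmonic_le_ln: "1 \<le> n \<Longrightarrow> (\<Sum>k=1..n. 1 / real k) \<le> 1 + ln (real n)"
proof -
  assume "1 \<le> n"
  then have "harm n - ln (real n) \<le> harm 1 - ln (1 :: real)"
    using decseqD[OF decseq_harm_diff_ln, of 0 "n - 1"] by simp
  moreover have "(\<Sum>k=1..n. 1 / real k) = harm n" by (simp add: harm_def inverse_eq_divide)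
  ultimately show ?thesis by (simp add: harm_expand)
qed

text \<open>
A prime above 16 satisfies \<open>4 \<le> sqrt p\<close>, and there are fewer than 16 smaller ones.
\<close>
lemma four_power_card_le:
  fixes D :: "nat set"
  assumes D: "finite D" "\<And>p. p \<in> D \<Longrightarrow> prime p"
  shows "4 ^ card D \<le> 4 ^ 16 * sqrt (real (\<Prod>D))"
proof -
  define f where "f p = (if p < 16 then 4 else 1 :: real)" for p :: nat
  have "4 ^ card D = (\<Prod>p\<in>D. 4 :: real)" by simp
  also have "\<dots> \<le> (\<Prod>p\<in>D. f p * sqrt (real p))"
  proof (rule prod_mono, rule conjI)
    fix p assume "p \<in> D"
    then have p1: "1 \<le> real p" using prime_ge_1_nat[OF D(2)] by simp
    show "4 \<le> f p * sqrt (real p)"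
    proof (cases "p < 16")
      case True
      then show ?thesis using p1 by (simp add: f_def)
    next
      case False
      then have "sqrt 16 \<le> sqrt (real p)" by (subst real_sqrt_le_iff) simp
      moreover have "sqrt 16 = (4 :: real)" by (rule real_sqrt_unique) simp_all
      ultimately show ?thesis using False by (simp add: f_def)
    qed
  qed simp
  also have "\<dots> = (\<Prod>p\<in>D. f p) * sqrt (real (\<Prod>D))"
    using D(1) by (induction D rule: finite_induct) (simp_all add: real_sqrt_mult mult_ac)
  also have "(\<Prod>p\<in>D. f p) = 4 ^ card (D \<inter> {..<16})"
  proof -
    have "(\<Prod>p\<in>D. f p) = (\<Prod>p\<in>D \<inter> {..<16}. 4)"
      using D(1) by (intro prod.mono_neutral_cong_right) (auto simp: f_def)
    then show ?thesis by simp
  qed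
  also have "4 ^ card (D \<inter> {..<16}) * sqrt (real (\<Prod>D)) \<le> 4 ^ 16 * sqrt (real (\<Prod>D))"
  proof (intro mult_right_mono power_increasing)
    have "card (D \<inter> {..<16}) \<le> card {..<16 :: nat}" by (rule card_mono) auto
    then show "card (D \<inter> {..<16}) \<le> 16" by simp
  qed (auto simp del: of_nat_prod)
  finally show ?thesis .
qed

lemma far_sum_reduced_nonneg: "0 \<le> c \<Longrightarrow> 0 \<le> far_sum_reduced b c m d"
  unfolding far_sum_reduced_def by (intro sum_nonneg) simp

text \<open>
Every fraction \<open>h / r\<close> strictly between 0 and 1 has a reduced form whose denominator divides \<open>r\<close>.
\<close>
lemma far_sum_le_reduced:
  assumes b: "0 < b" and c: "0 \<le> c" and r: "0 < r"
  shows "far_sum b c m r \<le> 1 + (\<Sum>d | d dvd r \<and> 1 < d. far_sum_reduced b c m d)"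
proof -
  define E where "E = {d. d dvd r \<and> 1 < d}"
  define f where "f h = c ^ far_count b m (real h / real r)" for h
  define g where "g = (\<lambda>(d, h). c ^ far_count b m (real h / real d))"
  define T where "T = (SIGMA d:E. {h. h < d \<and> coprime h d})"
  have finE: "finite E" unfolding E_def using r by (intro finite_subset[OF _ finite_divisors_nat[OF r]]) auto
  have finh: "finite {h. h < d \<and> coprime h d}" for d :: nat by simp
  have "{..<r} = insert 0 {1..<r}" using r by auto
  then have "far_sum b c m r = f 0 + sum f {1..<r}"
    unfolding far_sum_def f_def[symmetric] by simp
  also have "f 0 = 1" unfolding f_def using b by (simp add: far_count_0)
  also have "sum f {1..<r} \<le> sum g T"
  proof (rule sum_le_included[where i = "\<lambda>(d, h). h * (r div d)"])
    show "finite T" unfolding T_def using finE finh by (intro finite_SigmaI)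
    show "\<forall>y\<in>T. 0 \<le> g y" unfolding g_def using c by (simp add: case_prod_unfold)
    show "\<forall>h\<in>{1..<r}. \<exists>y\<in>T. (case y of (d, h) \<Rightarrow> h * (r div d)) = h \<and> f h \<le> g y"
    proof
      fix h assume h: "h \<in> {1..<r}"
      define e where "e = gcd h r"
      define h' where "h' = h div e"
      define d where "d = r div e"
      have e0: "0 < e" using r unfolding e_def by simp
      have hr: "h = h' * e" "r = d * e" unfolding h'_def d_def e_def by simp_all
      have cop: "coprime h' d" unfolding h'_def d_def e_def using r by (intro div_gcd_coprime) simp
      have "d dvd r" using hr(2) by (metis dvd_triv_left)
      moreover have "h' < d" using h e0 hr by (metis atLeastLessThan_iff mult_less_cancel2)
      moreover have "0 < h'" using h hr(1) by (metis atLeastLessThan_iff mult_is_0 neq0_conv not_one_le_zero)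
      ultimately have "(d, h') \<in> T" unfolding T_def E_def using cop by auto
      moreover have "r div d = e" using hr(2) \<open>h' < d\<close> by simp
      then have "h' * (r div d) = h" using hr(1) by simp
      moreover have "f h = g (d, h')" unfolding f_def g_def using e0 by (subst hr(1), subst hr(2)) simp
      ultimately show "\<exists>y\<in>T. (case y of (d, h) \<Rightarrow> h * (r div d)) = h \<and> f h \<le> g y"
        by (intro bexI[of _ "(d, h')"]) auto
    qed
  qed simp
  also have "sum g T = (\<Sum>d\<in>E. far_sum_reduced b c m d)"
    unfolding T_def far_sum_reduced_def g_def using finE finh by (intro sum.Sigma[symmetric]) auto
  finally show ?thesis unfolding E_def by simp
qed

context selberg
begin

text \<open>
Sorting the fractions by their reduced denominator \<open>d\<close> turns the weight \<open>1 / \<Prod>(A \<union> B)\<close> into the sum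
of these weights over all pairs with \<open>d dvd \<Prod>(A \<union> B)\<close>. By \<open>sum_inverse_lcm_le\<close> this is about \<open>1 / d\<close>,
and half of that exponent is given away to dispose of the factor \<open>4 ^ card D\<close>.
\<close>
lemma sum_far_sum_le:
  assumes b: "0 < b" and c: "0 \<le> c"
  shows "(\<Sum>(A, B)\<in>index \<times> index. far_sum b c m (\<Prod>(A \<union> B)) / real (\<Prod>(A \<union> B)))
    \<le> (\<Sum>(A, B)\<in>index \<times> index. 1 / real (\<Prod>(A \<union> B)))
      + 4 ^ 16 * (\<Sum>X\<in>index. 1 / real (\<Prod>X)) ^ 3
        * (\<Sum>d | 1 < d \<and> d \<le> Q * Q \<and> squarefree d \<and> prime_factors d \<subseteq> P. far_sum_reduced b c m d / sqrt (real d))"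
proof -
  define I where "I = index \<times> index"
  define r where "r = (\<lambda>(A, B). \<Prod>(A \<union> B :: nat set))"
  define D where "D = {d. 1 < d \<and> d \<le> Q * Q \<and> squarefree d \<and> prime_factors d \<subseteq> P}"
  define s where "s d = far_sum_reduced b c m d" for d
  define H where "H = (\<Sum>X\<in>index. 1 / real (\<Prod>X))"
  have finI: "finite I" unfolding I_def by simp
  have finD: "finite D" unfolding D_def by (rule finite_subset[of _ "{..Q * Q}"]) auto
  have s0: "0 \<le> s d" for d unfolding s_def using c by (rule far_sum_reduced_nonneg)
  have H0: "0 \<le> H" unfolding H_def by (intro sum_nonneg) (simp del: of_nat_prod)
  have r: "0 < r i" "r i \<le> Q * Q" "\<And>d. d dvd r i \<Longrightarrow> squarefree d \<and> prime_factors d \<subseteq> P \<and> prime_factors d \<subseteq> fst i \<union> snd i"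
    if i: "i \<in> I" for i
  proof -
    obtain A B where AB: "i = (A, B)" "A \<in> index" "B \<in> index" using i unfolding I_def by auto
    note un = index_Un[OF AB(2,3)]
    have ri: "r i = \<Prod>(A \<union> B)" unfolding r_def AB by simp
    show pos: "0 < r i" unfolding ri using un(2) by (intro prod_pos ballI prime_gt_0_nat)
    have "\<Prod>(A \<union> B) dvd \<Prod>A * \<Prod>B"
      by (metis prod.union_inter[OF indexD(2)[OF AB(2)] indexD(2)[OF AB(3)]] dvd_triv_left)
    then have "\<Prod>(A \<union> B) \<le> \<Prod>A * \<Prod>B" using prod_index_pos AB by (intro dvd_imp_le) auto
    also have "\<dots> \<le> Q * Q" using indexD(3) AB by (intro mult_mono) auto
    finally show "r i \<le> Q * Q" unfolding ri .
    fix d assume d: "d dvd r i"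
    have sq: "squarefree d" using d squarefree_prod_primes[OF un(2)] unfolding ri by (rule squarefree_mono)
    have "prime_factors d \<subseteq> prime_factors (r i)" using pos d by (intro dvd_prime_factors) auto
    also have "\<dots> = A \<union> B" unfolding ri by (rule prime_factors_prod_primes[OF un])
    finally show "squarefree d \<and> prime_factors d \<subseteq> P \<and> prime_factors d \<subseteq> fst i \<union> snd i"
      using sq indexD(1) AB by auto
  qed
  have "(\<Sum>i\<in>I. far_sum b c m (r i) / real (r i))
     \<le> (\<Sum>i\<in>I. 1 / real (r i) + (\<Sum>d | d \<in> D \<and> prime_factors d \<subseteq> fst i \<union> snd i. s d * (1 / real (r i))))"
  proof (rule sum_mono)
    fix i assume i: "i \<in> I"
    have "far_sum b c m (r i) \<le> 1 + (\<Sum>d | d dvd r i \<and> 1 < d. s d)"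
      unfolding s_def by (rule far_sum_le_reduced[OF b c r(1)[OF i]])
    also have "(\<Sum>d | d dvd r i \<and> 1 < d. s d) \<le> (\<Sum>d | d \<in> D \<and> prime_factors d \<subseteq> fst i \<union> snd i. s d)"
    proof (rule sum_mono2)
      show "{d. d dvd r i \<and> 1 < d} \<subseteq> {d \<in> D. prime_factors d \<subseteq> fst i \<union> snd i}"
      proof
        fix d assume "d \<in> {d. d dvd r i \<and> 1 < d}"
        then have d: "d dvd r i" "1 < d" by auto
        then have "d \<le> Q * Q" using dvd_imp_le[OF d(1) r(1)[OF i]] r(2)[OF i] by linarith
        then show "d \<in> {d \<in> D. prime_factors d \<subseteq> fst i \<union> snd i}" using r(3)[OF i d(1)] d(2) unfolding D_def by simp
      qed
    qed (use finD s0 in auto)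
    finally have "far_sum b c m (r i) / real (r i) \<le> (1 + (\<Sum>d | d \<in> D \<and> prime_factors d \<subseteq> fst i \<union> snd i. s d)) / real (r i)"
      by (intro divide_right_mono) auto
    also have "\<dots> = 1 / real (r i) + (\<Sum>d | d \<in> D \<and> prime_factors d \<subseteq> fst i \<union> snd i. s d * (1 / real (r i)))"
      by (simp add: add_divide_distrib sum_divide_distrib)
    finally show "far_sum b c m (r i) / real (r i) \<le> \<dots>" .
  qed
  also have "\<dots> = (\<Sum>i\<in>I. 1 / real (r i)) + (\<Sum>d\<in>D. \<Sum>i | i \<in> I \<and> prime_factors d \<subseteq> fst i \<union> snd i. s d * (1 / real (r i)))"
    unfolding sum.distrib by (subst sum.swap_restrict[OF finI finD]) simp
  also have "(\<Sum>d\<in>D. \<Sum>i | i \<in> I \<and> prime_factors d \<subseteq> fst i \<union> snd i. s d * (1 / real (r i)))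
     \<le> (\<Sum>d\<in>D. 4 ^ 16 * H ^ 3 * (s d / sqrt (real d)))"
  proof (rule sum_mono)
    fix d assume "d \<in> D"
    then have d: "1 < d" "squarefree d" "prime_factors d \<subseteq> P" unfolding D_def by auto
    have prod: "\<Prod>(prime_factors d) = d" by (rule prod_prime_factors_squarefree[OF d(2)])
    have "{i. i \<in> I \<and> prime_factors d \<subseteq> fst i \<union> snd i} = {(A, B). (A, B) \<in> index \<times> index \<and> prime_factors d \<subseteq> A \<union> B}"
      unfolding I_def by auto
    then have "(\<Sum>i | i \<in> I \<and> prime_factors d \<subseteq> fst i \<union> snd i. 1 / real (r i)) \<le> 4 ^ card (prime_factors d) / real d * H ^ 3"
      using sum_inverse_lcm_le[OF _ d(3)] unfolding prod H_def r_def by (simp only: case_prod_unfold finite_set_mset)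
    also have "\<dots> \<le> (4 ^ 16 * sqrt (real d)) / real d * H ^ 3"
      using four_power_card_le[of "prime_factors d"] H0 unfolding prod
      by (intro mult_right_mono divide_right_mono) auto
    also have "\<dots> = 4 ^ 16 * H ^ 3 * (1 / sqrt (real d))"
    proof -
      have "sqrt (real d) / real d = 1 / sqrt (real d)"
        using d(1) by (metis of_nat_0_le_iff sqrt_divide_self_eq inverse_eq_divide)
      then show ?thesis by (metis (no_types, lifting) mult.commute mult.left_commute times_divide_eq_right)
    qed
    finally have "s d * (\<Sum>i | i \<in> I \<and> prime_factors d \<subseteq> fst i \<union> snd i. 1 / real (r i)) \<le> s d * (4 ^ 16 * H ^ 3 * (1 / sqrt (real d)))"
      using s0 by (intro mult_left_mono)
    then show "(\<Sum>i | i \<in> I \<and> prime_factors d \<subseteq> fst i \<union> snd i. s d * (1 / real (r i))) \<le> 4 ^ 16 * H ^ 3 * (s d / sqrt (real d))"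
      unfolding sum_distrib_left[symmetric] by (simp add: mult_ac)
  qed
  also have "\<dots> = 4 ^ 16 * H ^ 3 * (\<Sum>d\<in>D. s d / sqrt (real d))" by (simp only: sum_distrib_left)
  finally show ?thesis unfolding I_def r_def D_def s_def H_def by (simp only: case_prod_unfold add_left_mono)
qed

end

section \<open>The upper bound for reversible primes\<close>

lemma digit_reverse_Suc: "digit_reverse b (Suc l) n = b * digit_reverse b l n + digit b n l"
proof -
  have "(\<Sum>j<l. digit b n j * b ^ (l - j)) = b * (\<Sum>j<l. digit b n j * b ^ (l - 1 - j))"
    unfolding sum_distrib_left
  proof (rule sum.cong[OF refl])
    fix j assume "j \<in> {..<l}"
    then have "l - j = Suc (l - 1 - j)" by auto
    then show "digit b n j * b ^ (l - j) = b * (digit b n j * b ^ (l - 1 - j))" by simp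
  qed
  then show ?thesis by (simp add: digit_reverse_def)
qed

lemma digit_reverse_eq_digits:
  assumes "b \<ge> 2" "digit_reverse b l n = digit_reverse b l n'" "j < l"
  shows "digit b n j = digit b n' j"
  using assms(2,3)
proof (induction l)
  case (Suc l)
  have less: "digit b n l < b" "digit b n' l < b" using digit_less[OF assms(1)] by auto
  have eq: "b * digit_reverse b l n + digit b n l = b * digit_reverse b l n' + digit b n' l"
    using Suc.prems(1) by (simp add: digit_reverse_Suc)
  from arg_cong[OF eq, of "\<lambda>x. x mod b"] have d: "digit b n l = digit b n' l" using less by simp
  then have "digit_reverse b l n = digit_reverse b l n'" using eq assms(1) by simp
  then show ?case using Suc.IH Suc.prems(2) d by (cases "j = l") auto
qed simp

lemma digit_reverse_inj:
  assumes "b \<ge> 2"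
  shows "inj_on (digit_reverse b l) {..<b ^ l}"
proof (rule inj_onI)
  fix n n' assume "n \<in> {..<b ^ l}" "n' \<in> {..<b ^ l}" and eq: "digit_reverse b l n = digit_reverse b l n'"
  then have "n < b ^ l" "n' < b ^ l" by auto
  then have "n = (\<Sum>j<l. digit b n j * b ^ j)" "n' = (\<Sum>j<l. digit b n' j * b ^ j)" by (auto intro: digit_expansion)
  moreover have "(\<Sum>j<l. digit b n j * b ^ j) = (\<Sum>j<l. digit b n' j * b ^ j)"
    using digit_reverse_eq_digits[OF assms eq] by (intro sum.cong refl) auto
  ultimately show "n = n'" by simp
qed

text \<open>
The level \<open>Q = b ^ M\<close> is chosen with \<open>M\<close> a small constant times \<open>l\<close>. Then \<open>G\<close> is at least of
order \<open>ln Q\<close>, hence of order \<open>l\<close>, while the relative error of the sieve is at most of order \<open>l ^ (- 2)\<close>. The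
finitely many primes dividing \<open>b (b ^ 2 - 1)\<close> are not used for sifting, at the cost of the constant \<open>W\<close>.
\<close>
proposition sifted_reversal_bound:
  fixes b :: nat
  assumes b: "b \<ge> 2"
  obtains C k where "0 < C" "\<And>l. k \<le> l \<Longrightarrow> \<exists>M. 2 * M \<le> l \<and>
     real (card {n. n < b ^ l \<and> (\<forall>p. prime p \<longrightarrow> p \<le> b ^ M \<longrightarrow> \<not> p dvd n \<and> \<not> p dvd digit_reverse b l n)})
      \<le> C * (real b ^ l / real l ^ 2)"
proof -
  obtain c where c: "0 < c" "c < 1"
    and phase: "\<And>l m. 20 * m \<le> l \<Longrightarrow> \<exists>u v. \<forall>s t.
       norm (\<Sum>n<b ^ l. cis (2 * pi * (s * real n + t * real (digit_reverse b l n))))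
       \<le> real b ^ l * (c ^ far_count b m (s * real ((b ^ 2 - 1) * b ^ u))
                      * c ^ far_count b m (t * real ((b ^ 2 - 1) * b ^ v)))"
    using phase_sum_bound[OF b] by blast
  have "0 < 1 / real b ^ 10" using b by simp
  then obtain j where j: "c ^ j < 1 / real b ^ 10" using real_arch_pow_inv c(2) by blast
  \<comment> \<open>Number of blocks needed for a far digit to bring in a factor at most 1 / b ^ 10.\<close>
  define K where "K = Suc j"
  have "c ^ K \<le> c ^ j" unfolding K_def using c by (intro power_decreasing) auto
  then have K: "0 < K" "c ^ K \<le> 1 / real b ^ 10" using j by (auto simp: K_def)
  obtain C0 where C0: "0 < C0" and total: "\<And>m M D. 4 * K * M \<le> m \<Longrightarrow>
       (\<And>d. d \<in> D \<Longrightarrow> 1 < d \<and> d < b ^ (10 * M) \<and> coprime b d) \<Longrightarrow>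
       (\<Sum>d\<in>D. far_sum_reduced b c m d / sqrt (real d)) * real m ^ 8 \<le> C0"
    using far_sum_reduced_total[OF b c K] by blast
  define a where "a = b * (b ^ 2 - 1)"
  have "1 < b ^ 2" using b by (intro one_less_power) auto
  then have a0: "0 < a" using b by (simp add: a_def)
  define W where "W = 2 * 2 ^ card (prime_factors a) * (1 :: real)"
  have W0: "0 < W" unfolding W_def by simp
  define L where "L = 1 + ln (real b)"
  have lnb: "0 < ln (real b)" using b by simp
  have L1: "1 \<le> L" unfolding L_def using lnb by simp
  define C1 where "C1 = 4 ^ 16 * L ^ 3 * C0"
  have C1: "0 < C1" unfolding C1_def using L1 C0 by simp
  define C2 where "C2 = (8 * real K * W / ln (real b)) ^ 2 + C1 * (2 * L ^ 3 + C1)"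
  have C2: "0 < C2" unfolding C2_def using C1 L1 by (intro add_nonneg_pos mult_pos_pos add_pos_pos) auto
  show ?thesis
  proof (rule that[of "C2 * 1600" "80 * K"])
    show "0 < C2 * 1600" using C2 by simp
  next
    fix l assume l: "80 * K \<le> l"
    \<comment> \<open>There are 2 m pairs of adjacent digits in l digits, one for each group of ten.\<close>
    define m where "m = l div 20"
    define M where "M = m div (4 * K)"
    define Q where "Q = b ^ M"
    define P where "P = {p. prime p \<and> p \<le> Q \<and> \<not> p dvd a}"
    define N where "N = b ^ l"
    have lm: "20 * m \<le> l" unfolding m_def by simp
    have mK: "4 * K \<le> m" unfolding m_def using l by linarith
    have M1: "1 \<le> M" unfolding M_def using mK K by (simp add: Suc_le_eq div_greater_zero_iff)
    have KM: "4 * K * M \<le> m" unfolding M_def by simp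
    have "m < 4 * K + 4 * K * M" unfolding M_def using K by (intro dividend_less_times_div) simp
    also have "\<dots> \<le> 8 * K * M" using M1 by simp
    finally have mM: "real m \<le> 8 * real K * real M" by (metis less_imp_le of_nat_le_iff of_nat_mult of_nat_numeral)
    have Mm: "M \<le> m" unfolding M_def by simp
    have m1: "1 \<le> real m" using mK K by simp
    have lm40: "real l \<le> 40 * real m"
    proof -
      have "l < 20 + 20 * m" unfolding m_def by (rule dividend_less_times_div) simp
      then have "l \<le> 40 * m" using mK K by linarith
      then show ?thesis by linarith
    qed
    have Q1: "1 \<le> Q" unfolding Q_def using b by simp
    have finP: "finite P" unfolding P_def by (rule finite_subset[of _ "{..Q}"]) auto
    interpret selberg P Q by standard (use finP Q1 in \<open>auto simp: P_def\<close>)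
    define H where "H = (\<Sum>X\<in>index. 1 / real (\<Prod>X))"
    define T0 where "T0 = (\<Sum>(A, B)\<in>index \<times> index. 1 / real (\<Prod>(A \<union> B)))"
    define T where "T = (\<Sum>(A, B)\<in>index \<times> index. far_sum b c m (\<Prod>(A \<union> B)) / real (\<Prod>(A \<union> B)))"
    define D where "D = {d. 1 < d \<and> d \<le> Q * Q \<and> squarefree d \<and> prime_factors d \<subseteq> P}"
    define E where "E = 4 ^ 16 * H ^ 3 * (\<Sum>d\<in>D. far_sum_reduced b c m d / sqrt (real d))"
    have H0: "0 \<le> H" unfolding H_def by (intro sum_nonneg) (simp del: of_nat_prod)
    have T00: "0 \<le> T0" unfolding T0_def by (intro sum_nonneg) (auto simp del: of_nat_prod)
    have far0: "0 \<le> far_sum b c m r" for r unfolding far_sum_def using c by (intro sum_nonneg) simp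
    then have T0': "0 \<le> T" unfolding T_def by (intro sum_nonneg) (auto simp del: of_nat_prod)
    have lnQ: "ln (real Q) = real M * ln (real b)" unfolding Q_def using b by (simp add: ln_realpow)
    have "H \<le> 1 + ln (real Q)"
      unfolding H_def using sum_index_le_harmonic harmonic_le_ln[OF Q1] by linarith
    also have "\<dots> \<le> real m + real m * ln (real b)"
      unfolding lnQ using m1 Mm lnb by (intro add_mono mult_right_mono) auto
    finally have HL: "H \<le> L * real m" unfolding L_def by (simp add: algebra_simps)
    have "real m * ln (real b) \<le> 8 * real K * real M * ln (real b)"
      using mM lnb by (intro mult_right_mono) auto
    also have "\<dots> = 8 * real K * ln (real Q)" unfolding lnQ by simp
    also have "\<dots> \<le> 8 * real K * (W * G)"
    proof (intro mult_left_mono)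
      have "ln (real Q) \<le> W * H"
        using ln_le_harmonic[of Q] harmonic_le_squarefree_sum[OF P_def a0 Q1] unfolding W_def H_def by simp
      also have "\<dots> \<le> W * G" unfolding H_def using W0 sum_index_le_G by (intro mult_left_mono) auto
      finally show "ln (real Q) \<le> W * G" .
    qed simp
    finally have "real m * ln (real b) \<le> 8 * real K * W * G" by (simp add: mult.assoc)
    then have "1 / G \<le> (8 * real K * W / ln (real b)) / real m"
      using G_ge_1 lnb m1 by (simp add: field_simps)
    then have G2: "(1 / G) ^ 2 \<le> (8 * real K * W / ln (real b)) ^ 2 / real m ^ 2"
      using G_ge_1 unfolding power_divide[symmetric] by (intro power_mono) auto
    have coprime_P: "coprime a p" if "p \<in> P" for p
      using that prime_imp_coprime[of p a] unfolding P_def by (simp add: coprime_commute)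
    have "(\<Sum>d\<in>D. far_sum_reduced b c m d / sqrt (real d)) * real m ^ 8 \<le> C0"
    proof (rule total[OF KM])
      fix d assume "d \<in> D"
      then have d: "1 < d" "d \<le> Q * Q" "squarefree d" "prime_factors d \<subseteq> P" unfolding D_def by auto
      \<comment> \<open>Least common multiples are at most Q * Q, well inside the admissible range of denominators.\<close>
      have "Q * Q = b ^ (2 * M)" unfolding Q_def by (simp add: mult_2 power_add)
      also have "\<dots> < b ^ (10 * M)" using b M1 by (intro power_strict_increasing) auto
      finally have "d < b ^ (10 * M)" using d by simp
      moreover have "coprime a (\<Prod>(prime_factors d))"
        using coprime_P d(4) by (intro prod_coprime_right) auto
      then have "coprime b d" unfolding prod_prime_factors_squarefree[OF d(3)] a_def by simp
      ultimately show "1 < d \<and> d < b ^ (10 * M) \<and> coprime b d" using d by simp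
    qed
    then have sumD: "(\<Sum>d\<in>D. far_sum_reduced b c m d / sqrt (real d)) \<le> C0 / real m ^ 8"
      using m1 by (simp add: field_simps)
    have sumD0: "0 \<le> (\<Sum>d\<in>D. far_sum_reduced b c m d / sqrt (real d))"
      using c by (intro sum_nonneg divide_nonneg_nonneg far_sum_reduced_nonneg) auto
    have E0: "0 \<le> E" unfolding E_def using H0 sumD0 by simp
    have "E \<le> 4 ^ 16 * (L * real m) ^ 3 * (C0 / real m ^ 8)"
      unfolding E_def using HL H0 sumD sumD0 L1 m1 by (intro mult_mono mult_left_mono power_mono) auto
    also have "\<dots> = C1 / real m ^ 5"
      unfolding C1_def using m1 by (simp add: power_mult_distrib field_simps flip: power_add)
    finally have E5: "E \<le> C1 / real m ^ 5" .
    have "C1 / real m ^ 5 \<le> C1" using C1 m1 by (simp add: divide_le_eq mult_left_mono)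
    then have EC1: "E \<le> C1 * real m ^ 3" using E5 C1 m1 by (smt (verit) mult_le_cancel_left1 one_le_power)
    have "T0 \<le> H ^ 3"
    proof -
      have "{(A, B). (A, B) \<in> index \<times> index \<and> {} \<subseteq> A \<union> B} = index \<times> index" by auto
      then show ?thesis using sum_inverse_lcm_le[of "{}"] unfolding T0_def H_def by (simp del: of_nat_prod)
    qed
    also have "\<dots> \<le> (L * real m) ^ 3" using HL H0 by (intro power_mono)
    finally have T03: "T0 \<le> L ^ 3 * real m ^ 3" by (simp add: power_mult_distrib)
    have "T \<le> T0 + E"
      unfolding T_def T0_def E_def H_def D_def using b c by (intro sum_far_sum_le) auto
    then have "T ^ 2 \<le> (T0 + E) ^ 2" using T0' by (intro power_mono)
    then have "T ^ 2 - T0 ^ 2 \<le> E * (2 * T0 + E)" by (simp add: power2_eq_square algebra_simps)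
    also have "\<dots> \<le> (C1 / real m ^ 5) * (2 * (L ^ 3 * real m ^ 3) + C1 * real m ^ 3)"
      using E0 E5 T00 T03 EC1 C1 by (intro mult_mono add_mono mult_left_mono) auto
    also have "\<dots> = C1 * (2 * L ^ 3 + C1) / real m ^ 2"
    proof -
      have "real m ^ 5 = real m ^ 2 * real m ^ 3" by (simp flip: power_add)
      then show ?thesis using m1 by (simp add: field_simps)
    qed
    finally have TT: "T ^ 2 - T0 ^ 2 \<le> C1 * (2 * L ^ 3 + C1) / real m ^ 2" .
    obtain u v where uv: "\<And>s t. norm (\<Sum>n<N. cis (2 * pi * (s * real n + t * real (digit_reverse b l n))))
       \<le> real N * (c ^ far_count b m (s * real ((b ^ 2 - 1) * b ^ u))
                      * c ^ far_count b m (t * real ((b ^ 2 - 1) * b ^ v)))"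
      using phase[OF lm] unfolding N_def of_nat_power by blast
    have lcm_ok: "0 < \<Prod>(A \<union> B)" "coprime (b * (b ^ 2 - 1)) (\<Prod>(A \<union> B))" if AB: "A \<in> index" "B \<in> index" for A B
    proof -
      show "0 < \<Prod>(A \<union> B)" using index_Un(2)[OF AB] by (intro prod_pos ballI prime_gt_0_nat)
      show "coprime (b * (b ^ 2 - 1)) (\<Prod>(A \<union> B))"
        using coprime_P indexD(1)[OF AB(1)] indexD(1)[OF AB(2)] unfolding a_def
        by (intro prod_coprime_right) blast
    qed
    have "real (card {n. n < N \<and> (\<forall>p\<in>P. \<not> p dvd n) \<and> (\<forall>p\<in>P. \<not> p dvd digit_reverse b l n)})
        \<le> real N * ((1 / G) ^ 2 + T ^ 2 - T0 ^ 2)"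
      unfolding T_def T0_def
      by (intro joint_sieve joint_multiples_discrepancy[OF b _ _ _ _ c(1) uv] lcm_ok)
    also have "\<dots> \<le> real N * (C2 / real m ^ 2)"
      unfolding C2_def using G2 TT by (intro mult_left_mono) (auto simp: add_divide_distrib)
    also have "\<dots> \<le> real N * (C2 * 1600 / real l ^ 2)"
    proof (intro mult_left_mono)
      have l0: "0 < real l" using l K by simp
      have "real l ^ 2 \<le> (40 * real m) ^ 2" using lm40 by (intro power_mono) auto
      then have "C2 * real l ^ 2 \<le> C2 * (1600 * real m ^ 2)" using C2 by (simp add: power_mult_distrib)
      then show "C2 / real m ^ 2 \<le> C2 * 1600 / real l ^ 2" using l0 m1 by (simp add: field_simps)
    qed simp
    finally have main: "real (card {n. n < N \<and> (\<forall>p\<in>P. \<not> p dvd n) \<and> (\<forall>p\<in>P. \<not> p dvd digit_reverse b l n)})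
        \<le> C2 * 1600 * (real b ^ l / real l ^ 2)" unfolding N_def by (simp add: mult_ac)
    have "card {n. n < b ^ l \<and> (\<forall>p. prime p \<longrightarrow> p \<le> b ^ M \<longrightarrow> \<not> p dvd n \<and> \<not> p dvd digit_reverse b l n)}
       \<le> card {n. n < N \<and> (\<forall>p\<in>P. \<not> p dvd n) \<and> (\<forall>p\<in>P. \<not> p dvd digit_reverse b l n)}"
      unfolding N_def P_def Q_def by (intro card_mono) auto
    moreover have "2 * M \<le> l" using Mm lm by linarith
    ultimately show "\<exists>M. 2 * M \<le> l \<and>
     real (card {n. n < b ^ l \<and> (\<forall>p. prime p \<longrightarrow> p \<le> b ^ M \<longrightarrow> \<not> p dvd n \<and> \<not> p dvd digit_reverse b l n)})
      \<le> C2 * 1600 * (real b ^ l / real l ^ 2)"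
      using main by (intro exI[of _ M]) linarith
  qed
qed

text \<open>
A prime \<open>n\<close> with prime reversal is either sifted or one of \<open>n\<close> and its reversal is at most
\<open>b ^ M\<close>. As the reversal is injective, the second case concerns at most \<open>2 (b ^ M + 1)\<close> integers, which is
negligible because \<open>2 M \<le> l\<close>. The finitely many \<open>l\<close> below the threshold \<open>k\<close> are covered by the trivial
bound \<open>b ^ l\<close>.
\<close>
theorem theorem1p2:
  fixes b :: nat
  assumes "b \<ge> 2"
  shows "\<exists>C>0. \<forall>l::nat. l \<ge> 1 \<longrightarrow>
    real (card {p::nat. prime p \<and> b ^ (l - 1) \<le> p \<and> p < b ^ l \<and> prime (digit_reverse b l p)})
      \<le> C * (real b ^ l / real l ^ 2)"
proof -
  note b = assms
  obtain C k where C: "0 < C" and sifted: "\<And>l. k \<le> l \<Longrightarrow> \<exists>M. 2 * M \<le> l \<and>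
     real (card {n. n < b ^ l \<and> (\<forall>p. prime p \<longrightarrow> p \<le> b ^ M \<longrightarrow> \<not> p dvd n \<and> \<not> p dvd digit_reverse b l n)})
      \<le> C * (real b ^ l / real l ^ 2)"
    using sifted_reversal_bound[OF b] by blast
  have "(0 :: real) \<le> sqrt (1 / 2)" "sqrt (1 / 2) < (1 :: real)" by simp_all
  then obtain C' where C': "0 < C'" "\<And>n. real n ^ 2 * sqrt (1 / 2) ^ n \<le> C'"
    using power_times_geometric_bounded[of "sqrt (1 / 2)" 2] by auto
  define C'' where "C'' = C + 4 * C' + real k ^ 2"
  have "0 < C''" unfolding C''_def using C C' by (simp add: add_pos_nonneg)
  moreover have "real (card {p. prime p \<and> b ^ (l - 1) \<le> p \<and> p < b ^ l \<and> prime (digit_reverse b l p)})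
      \<le> C'' * (real b ^ l / real l ^ 2)" if l: "1 \<le> l" for l
  proof -
    define S where "S = {p. prime p \<and> b ^ (l - 1) \<le> p \<and> p < b ^ l \<and> prime (digit_reverse b l p)}"
    define r where "r = real b ^ l / real l ^ 2"
    have r0: "0 \<le> r" unfolding r_def by simp
    show ?thesis
    proof (cases "k \<le> l")
      case False
      have "card S \<le> card {..<b ^ l}" unfolding S_def by (intro card_mono) auto
      then have "real (card S) \<le> real b ^ l" by (simp flip: of_nat_power)
      also have "\<dots> = real l ^ 2 * r" unfolding r_def using l by simp
      also have "\<dots> \<le> real k ^ 2 * r" using False r0 by (intro mult_right_mono power_mono) auto
      also have "\<dots> \<le> C'' * r" unfolding C''_def using r0 C C' by (intro mult_right_mono) auto
      finally show ?thesis unfolding S_def r_def .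
    next
      case True
      from sifted[OF True] obtain M where M: "2 * M \<le> l" and bound:
        "real (card {n. n < b ^ l \<and> (\<forall>p. prime p \<longrightarrow> p \<le> b ^ M \<longrightarrow> \<not> p dvd n \<and> \<not> p dvd digit_reverse b l n)}) \<le> C * r"
        unfolding r_def by blast
      define A where "A = {n. n < b ^ l \<and> (\<forall>p. prime p \<longrightarrow> p \<le> b ^ M \<longrightarrow> \<not> p dvd n \<and> \<not> p dvd digit_reverse b l n)}"
      define B where "B = {n. n < b ^ l \<and> digit_reverse b l n \<le> b ^ M}"
      have fins: "finite A" "finite B" unfolding A_def B_def by auto
      have "S \<subseteq> A \<union> ({..b ^ M} \<union> B)"
      proof
        fix n assume n: "n \<in> S"
        then have primes: "prime n" "prime (digit_reverse b l n)" "n < b ^ l" unfolding S_def by auto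
        show "n \<in> A \<union> ({..b ^ M} \<union> B)"
        proof (cases "n \<le> b ^ M \<or> digit_reverse b l n \<le> b ^ M")
          case True
          then show ?thesis using primes unfolding B_def by auto
        next
          case False
          then have "\<not> p dvd n \<and> \<not> p dvd digit_reverse b l n" if "prime p" "p \<le> b ^ M" for p
            using that primes primes_dvd_imp_eq[of p] by auto
          then show ?thesis using primes unfolding A_def by auto
        qed
      qed
      then have "card S \<le> card (A \<union> ({..b ^ M} \<union> B))" using fins by (intro card_mono) auto
      also have "\<dots> \<le> card A + (card {..b ^ M} + card B)"
        using card_Un_le[of A "{..b ^ M} \<union> B"] card_Un_le[of "{..b ^ M}" B] by linarith
      also have "card B \<le> card {..b ^ M}"
      proof (rule card_inj_on_le)
        show "inj_on (digit_reverse b l) B"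
          by (rule inj_on_subset[OF digit_reverse_inj[OF b]]) (auto simp: B_def)
      qed (auto simp: B_def)
      finally have card: "card S \<le> card A + (card {..b ^ M} + card {..b ^ M})" by simp
      have "1 \<le> b ^ M" using b by simp
      then have "card {..b ^ M} + card {..b ^ M} \<le> 4 * b ^ M" by simp
      with card have "card S \<le> card A + 4 * b ^ M" by linarith
      then have "real (card S) \<le> real (card A) + 4 * real b ^ M" by (simp flip: of_nat_power)
      also have "real b ^ M \<le> C' * r"
      proof -
        have "real b ^ l = real b ^ M * real b ^ (l - M)" using M by (simp flip: power_add)
        moreover have "1 \<le> real b ^ (l - M) * sqrt (1 / 2) ^ l"
        proof -
          have "(1 :: real) = (2 * (1 / 2)) ^ (l - M)" by simp
          also have "\<dots> = 2 ^ (l - M) * sqrt (1 / 2) ^ (2 * (l - M))"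
            unfolding power_mult_distrib by (simp add: power_mult)
          also have "\<dots> \<le> real b ^ (l - M) * sqrt (1 / 2) ^ l"
            using b M by (intro mult_mono power_mono power_decreasing) auto
          finally show ?thesis .
        qed
        ultimately have "real b ^ M * 1 \<le> real b ^ l * sqrt (1 / 2) ^ l"
          using b by (simp add: mult.assoc mult_left_mono)
        also have "\<dots> = r * (real l ^ 2 * sqrt (1 / 2) ^ l)" unfolding r_def using l by simp
        also have "\<dots> \<le> r * C'" using r0 C' by (intro mult_left_mono)
        finally show ?thesis by (simp add: mult.commute)
      qed
      also have "real (card A) \<le> C * r" using bound unfolding A_def .
      finally have "real (card S) \<le> (C + 4 * C') * r" by (simp add: algebra_simps)
      also have "\<dots> \<le> C'' * r" unfolding C''_def using r0 by (intro mult_right_mono) auto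
      finally show ?thesis unfolding S_def r_def .
    qed
  qed
  ultimately show ?thesis by blast
qed

end
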